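(* Let $a,b$ be coprime positive integers. Then, as formal power series in $z$ with coefficients in the ring $\mathbb{Q}\otimes\Lambda[y]$ of polynomials in $y$ over symmetric functions in $\mathbf{x}$, $$\sum_{d\geq 0} S_{ad,bd}(\mathbf{x};y)\,z^d=\exp\!\left(\sum_{j\geq 1} e_{jb}[ja\,(\mathbf{x}+y)]\,\frac{z^j}{aj}\right),$$ where $S_{m,n}(\mathbf{x};y)$ is the symmetric function enumerator of $(m,n)$-Schröder paths and $S_{0,0}(\mathbf{x};y)=1$.
   Context: For non-negative integers $m,n$, an $(m,n)$-Schröder path is a sequence of points $(u,v)\in\mathbb{N}\times\mathbb{N}$ starting at $(0,0)$ and ending at $(m,n)$, all satisfying $mv-nu\geq 0$, in which each next point is obtained by adding $(0,1)$ (up step), $(1,1)$ (diagonal step) or $(1,0)$ (right step). For such a path $\alpha$, $\mathrm{diag}(\alpha)$ is the number of its diagonal steps, and $\gamma(\alpha)$ is the list of the lengths of its risers, i.e. of its maximal sequences of consecutive up steps. $\Lambda$ is the ring of symmetric functions in $\mathbf{x}=x_1,x_2,x_3,\ldots$; the elementary symmetric functions $e_k(\mathbf{x})$ are given by $\sum_{k\geq0}e_k(\mathbf{x})z^k=\prod_{i\geq1}(1+x_iz)$, so $e_0=1$; $p_k(\mathbf{x})=\sum_i x_i^k$ are the power sums. The weight of a path is $\alpha(\mathbf{x}):=\prod_{k\in\gamma(\alpha)}e_k(\mathbf{x})$ (product with multiplicity, equal to $1$ if there is no riser), and $$S_{m,n}(\mathbf{x};y):=\sum_{\alpha}\alpha(\mathbf{x})\,y^{\mathrm{diag}(\alpha)},$$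 the sum being over all $(m,n)$-Schröder paths $\alpha$. Plethystic notation: $\mathbf{x}+y$ means that the variable $y$ is added to the variables $\mathbf{x}$, and for a positive integer $N$ (treated as a constant), $$e_n[N(\mathbf{x}+y)]:=\sum_{\nu\vdash n}(-1)^{n-\ell(\nu)}N^{\ell(\nu)}\frac{1}{z_\nu}\prod_{i=1}^{\ell(\nu)}\left(p_{\nu_i}(\mathbf{x})+y^{\nu_i}\right),$$ where $\ell(\nu)$ is the number of parts of $\nu$ and $z_\nu=1^{d_1}d_1!\,2^{d_2}d_2!\cdots n^{d_n}d_n!$ with $d_i$ the number of parts of $\nu$ equal to $i$. Equivalently, $e_n[N(\mathbf{x}+y)]$ is the coefficient of $w^n$ in $\left((1+yw)\prod_{i\geq1}(1+x_iw)\right)^N$. *)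

theory Defs
  imports
    "HOL-Library.Multiset"
    "HOL-Computational_Algebra.Polynomial"
    "HOL-Computational_Algebra.Formal_Power_Series"
begin

section \<open>Formal power series in countably many variables over the rationals\<close>

text \<open>
  The monomial \<open>x\<^bsub>i\<^esub> x\<^bsub>j\<^esub> x\<^bsub>k\<^esub> \<dots>\<close> is encoded as the multiset \<open>{#i, j, k, \<dots>#}\<close> of the indices of its
  variables: products of monomials are sums of multisets and the degree is the size. The variables
  are indexed from \<open>0\<close>.
\<close>

typedef mvps = "UNIV :: (nat multiset \<Rightarrow> rat) set"
  morphisms mcoeff Abs_mvps ..

setup_lifting type_definition_mvps

lemma mvps_eqI: "(\<And>m. mcoeff f m = mcoeff g m) \<Longrightarrow> f = g"
  by (metis ext mcoeff_inject)

lemma finite_msplit: "finite {(k, l). k + l = (m :: 'a multiset)}"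
proof (induction m)
  case empty
  then show ?case by simp
next
  case (add a m)
  let ?S = "{(k, l). k + l = m}"
  have "{(k, l). k + l = add_mset a m} \<subseteq>
      (\<lambda>(k, l). (add_mset a k, l)) ` ?S \<union> (\<lambda>(k, l). (k, add_mset a l)) ` ?S"
  proof (clarify)
    fix k l :: "'a multiset"
    assume eq: "k + l = add_mset a m"
      and n: "(k, l) \<notin> (\<lambda>(k, l). (k, add_mset a l)) ` ?S"
    have "a \<in># k + l" using eq by simp
    then consider "a \<in># k" | "a \<in># l" by auto
    then show "(k, l) \<in> (\<lambda>(k, l). (add_mset a k, l)) ` ?S"
    proof cases
      case 1
      then obtain k' where "k = add_mset a k'" by (metis mset_add)
      then show ?thesis using eq by force
    next
      case 2
      then obtain l' where "l = add_mset a l'" by (metis mset_add)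
      then show ?thesis using eq n by force
    qed
  qed
  then show ?case using add.IH by (auto intro: finite_subset)
qed

instantiation mvps :: comm_ring_1
begin

lift_definition zero_mvps :: mvps is "\<lambda>m. 0" .
lift_definition one_mvps :: mvps is "\<lambda>m. if m = {#} then 1 else 0" .
lift_definition plus_mvps :: "mvps \<Rightarrow> mvps \<Rightarrow> mvps" is "\<lambda>f g m. f m + g m" .
lift_definition minus_mvps :: "mvps \<Rightarrow> mvps \<Rightarrow> mvps" is "\<lambda>f g m. f m - g m" .
lift_definition uminus_mvps :: "mvps \<Rightarrow> mvps" is "\<lambda>f m. - f m" .
lift_definition times_mvps :: "mvps \<Rightarrow> mvps \<Rightarrow> mvps"
  is "\<lambda>f g m. \<Sum>(k, l) \<in> {(k, l). k + l = m}. f k * g l" .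

instance
proof
  fix f g h :: mvps
  show "f * g = g * f"
  proof (transfer, rule ext)
    fix f g :: "nat multiset \<Rightarrow> rat" and m
    show "(\<Sum>(k, l) \<in> {(k, l). k + l = m}. f k * g l) = (\<Sum>(k, l) \<in> {(k, l). k + l = m}. g k * f l)"
      by (rule sum.reindex_bij_witness[of _ prod.swap prod.swap]) (auto simp: ac_simps)
  qed
  show "f * g * h = f * (g * h)"
  proof (transfer, rule ext)
    fix f g h :: "nat multiset \<Rightarrow> rat" and m
    let ?S = "\<lambda>m. {(k, l). k + l = (m :: nat multiset)}"
    have "(\<Sum>(k, l) \<in> ?S m. (\<Sum>(i, j) \<in> ?S k. f i * g j) * h l)
        = (\<Sum>x \<in> ?S m. \<Sum>y \<in> ?S (fst x). f (fst y) * g (snd y) * h (snd x))"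
      by (simp add: sum_distrib_right case_prod_unfold)
    also have "\<dots> = (\<Sum>(x, y) \<in> Sigma (?S m) (\<lambda>x. ?S (fst x)). f (fst y) * g (snd y) * h (snd x))"
      by (rule sum.Sigma) (auto simp: finite_msplit)
    also have "\<dots> = (\<Sum>(x, y) \<in> Sigma (?S m) (\<lambda>x. ?S (snd x)). f (fst x) * (g (fst y) * h (snd y)))"
      by (rule sum.reindex_bij_witness[of _ "\<lambda>((i, r), (j, l)). ((i + j, l), (i, j))"
            "\<lambda>((k, l), (i, j)). ((i, j + l), (j, l))"]) (auto simp: ac_simps)
    also have "\<dots> = (\<Sum>x \<in> ?S m. \<Sum>y \<in> ?S (snd x). f (fst x) * (g (fst y) * h (snd y)))"
      by (rule sum.Sigma[symmetric]) (auto simp: finite_msplit)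
    also have "\<dots> = (\<Sum>(i, r) \<in> ?S m. f i * (\<Sum>(j, l) \<in> ?S r. g j * h l))"
      by (simp add: sum_distrib_left case_prod_unfold)
    finally show "(\<Sum>(k, l) \<in> ?S m. (\<Sum>(i, j) \<in> ?S k. f i * g j) * h l)
        = (\<Sum>(i, r) \<in> ?S m. f i * (\<Sum>(j, l) \<in> ?S r. g j * h l))" .
  qed
  show "1 * f = f"
  proof (transfer, rule ext)
    fix f :: "nat multiset \<Rightarrow> rat" and m
    let ?h = "\<lambda>(k :: nat multiset, l). (if k = {#} then 1 else 0) * f l"
    have "sum ?h {(k, l). k + l = m} = sum ?h {({#}, m)}"
      by (rule sum.mono_neutral_right) (auto simp: finite_msplit split: if_splits)
    then show "(\<Sum>(k, l) \<in> {(k, l). k + l = m}. (if k = {#} then 1 else 0) * f l) = f m"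
      by simp
  qed
  show "(f + g) * h = f * h + g * h"
    by transfer (simp add: case_prod_unfold distrib_right sum.distrib)
  show "(0 :: mvps) \<noteq> 1"
    by transfer (metis zero_neq_one)
qed (transfer; simp add: fun_eq_iff)+

end

lift_definition mvps_const :: "rat \<Rightarrow> mvps" is "\<lambda>c m. if m = {#} then c else 0" .

lift_definition mvps_var :: "nat \<Rightarrow> mvps" is "\<lambda>i m. if m = {#i#} then 1 else 0" .


section \<open>Symmetric functions\<close>

definition mvps_bounded_degree :: "mvps \<Rightarrow> bool" where
  "mvps_bounded_degree f \<longleftrightarrow> (\<exists>d. \<forall>m. mcoeff f m \<noteq> 0 \<longrightarrow> size m \<le> d)"

definition mvps_symmetric :: "mvps \<Rightarrow> bool" where
  "mvps_symmetric f \<longleftrightarrow> (\<forall>\<pi>. bij \<pi> \<longrightarrow> (\<forall>m. mcoeff f (image_mset \<pi> m) = mcoeff f m))"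

lemma mvps_bounded_degree_times:
  assumes "mvps_bounded_degree f" "mvps_bounded_degree g"
  shows "mvps_bounded_degree (f * g)"
proof -
  from assms obtain c d where c: "\<And>m. mcoeff f m \<noteq> 0 \<Longrightarrow> size m \<le> c"
    and d: "\<And>m. mcoeff g m \<noteq> 0 \<Longrightarrow> size m \<le> d"
    unfolding mvps_bounded_degree_def by blast
  have "size m \<le> c + d" if "mcoeff (f * g) m \<noteq> 0" for m
  proof -
    have "(\<Sum>(k, l) \<in> {(k, l). k + l = m}. mcoeff f k * mcoeff g l) \<noteq> 0"
      using that by (simp add: times_mvps.rep_eq)
    then obtain k l where "k + l = m" "mcoeff f k * mcoeff g l \<noteq> 0"
      by (auto elim: sum.not_neutral_contains_not_neutral)
    then show ?thesis using c[of k] d[of l] by auto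
  qed
  then show ?thesis unfolding mvps_bounded_degree_def by blast
qed

lemma mvps_symmetric_times:
  assumes f: "mvps_symmetric f" and g: "mvps_symmetric g"
  shows "mvps_symmetric (f * g)"
  unfolding mvps_symmetric_def
proof (intro allI impI)
  fix \<pi> :: "nat \<Rightarrow> nat" and m
  assume b: "bij \<pi>"
  have inv: "image_mset \<pi> (image_mset (inv \<pi>) k) = k" "image_mset (inv \<pi>) (image_mset \<pi> k) = k" for k
    using b by (simp_all add: multiset.map_comp comp_def bij_is_inj bij_is_surj surj_f_inv_f)
  show "mcoeff (f * g) (image_mset \<pi> m) = mcoeff (f * g) m"
    unfolding times_mvps.rep_eq
    by (rule sum.reindex_bij_witness[of _ "map_prod (image_mset \<pi>) (image_mset \<pi>)"
          "map_prod (image_mset (inv \<pi>)) (image_mset (inv \<pi>))"])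
      (use b f g inv in \<open>auto simp: mvps_symmetric_def bij_imp_bij_inv simp flip: image_mset_union\<close>)
qed

typedef symfun = "{f. mvps_bounded_degree f \<and> mvps_symmetric f}"
  morphisms mvps_of_symfun Abs_symfun
  by (rule exI[of _ 0]) (simp add: mvps_bounded_degree_def mvps_symmetric_def zero_mvps.rep_eq)

setup_lifting type_definition_symfun

instantiation symfun :: comm_ring_1
begin

lift_definition zero_symfun :: symfun is 0
  by (simp add: mvps_bounded_degree_def mvps_symmetric_def zero_mvps.rep_eq)
lift_definition one_symfun :: symfun is 1
  by (auto simp: mvps_bounded_degree_def mvps_symmetric_def one_mvps.rep_eq)
lift_definition plus_symfun :: "symfun \<Rightarrow> symfun \<Rightarrow> symfun" is "(+)"
proof -
  fix f g
  assume f: "mvps_bounded_degree f \<and> mvps_symmetric f" and g: "mvps_bounded_degree g \<and> mvps_symmetric g"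
  then obtain c d where "\<And>m. mcoeff f m \<noteq> 0 \<Longrightarrow> size m \<le> c" "\<And>m. mcoeff g m \<noteq> 0 \<Longrightarrow> size m \<le> d"
    unfolding mvps_bounded_degree_def by blast
  then have "\<forall>m. mcoeff (f + g) m \<noteq> 0 \<longrightarrow> size m \<le> max c d"
    by (metis add_cancel_right_right le_max_iff_disj plus_mvps.rep_eq)
  then show "mvps_bounded_degree (f + g) \<and> mvps_symmetric (f + g)"
    using f g by (auto simp: mvps_bounded_degree_def mvps_symmetric_def plus_mvps.rep_eq)
qed
lift_definition uminus_symfun :: "symfun \<Rightarrow> symfun" is uminus
  by (simp add: mvps_bounded_degree_def mvps_symmetric_def uminus_mvps.rep_eq)
definition minus_symfun :: "symfun \<Rightarrow> symfun \<Rightarrow> symfun" where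
  "minus_symfun f g = f + (- g)"
lift_definition times_symfun :: "symfun \<Rightarrow> symfun \<Rightarrow> symfun" is "(*)"
  by (simp add: mvps_bounded_degree_times mvps_symmetric_times)

instance
proof
  fix f g h :: symfun
  show "f * g * h = f * (g * h)" by transfer (rule mult.assoc)
  show "f * g = g * f" by transfer (rule mult.commute)
  show "1 * f = f" by transfer simp
  show "(f + g) * h = f * h + g * h" by transfer (rule distrib_right)
  show "f + g + h = f + (g + h)" by transfer (rule add.assoc)
  show "f + g = g + f" by transfer (rule add.commute)
  show "0 + f = f" by transfer simp
  show "- f + f = 0" by transfer simp
  show "f - g = f + - g" by (rule minus_symfun_def)
  show "(0 :: symfun) \<noteq> 1" by transfer simp
qed

end

lift_definition sf_const :: "rat \<Rightarrow> symfun" is mvps_const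
  by (auto simp: mvps_bounded_degree_def mvps_symmetric_def mvps_const.rep_eq)

lift_definition elem_sf_series :: "nat \<Rightarrow> mvps"
  is "\<lambda>k m. if size m = k \<and> (\<forall>i. count m i \<le> 1) then 1 else 0" .

lift_definition elem_sf :: "nat \<Rightarrow> symfun" is elem_sf_series
proof -
  fix k
  have "(\<forall>i. count (image_mset \<pi> m) i \<le> 1) \<longleftrightarrow> (\<forall>i. count m i \<le> 1)" if "bij \<pi>" for \<pi> and m :: "nat multiset"
  proof -
    have "count (image_mset \<pi> m) (\<pi> i) = count m i" for i
      by (induction m) (use that in \<open>auto simp: bij_def inj_eq\<close>)
    then show ?thesis using that by (metis bij_pointE)
  qed
  then show "mvps_bounded_degree (elem_sf_series k) \<and> mvps_symmetric (elem_sf_series k)"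
    by (auto simp: mvps_bounded_degree_def mvps_symmetric_def elem_sf_series.rep_eq)
qed

text \<open>Meaningful as a power sum only for \<open>k \<ge> 1\<close>.\<close>

lift_definition power_sum_series :: "nat \<Rightarrow> mvps"
  is "\<lambda>k m. if \<exists>i. m = replicate_mset k i then 1 else 0" .

lift_definition power_sum :: "nat \<Rightarrow> symfun" is power_sum_series
proof -
  fix k
  have "(\<exists>i. image_mset \<pi> m = replicate_mset k i) \<longleftrightarrow> (\<exists>i. m = replicate_mset k i)"
    if b: "bij \<pi>" for \<pi> and m :: "nat multiset"
  proof
    assume "\<exists>i. image_mset \<pi> m = replicate_mset k i"
    then obtain i where "image_mset (inv \<pi>) (image_mset \<pi> m) = image_mset (inv \<pi>) (replicate_mset k i)"
      by auto
    then have "m = replicate_mset k (inv \<pi> i)"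
      using b by (simp add: multiset.map_comp comp_def bij_is_inj)
    then show "\<exists>i. m = replicate_mset k i" by blast
  qed auto
  then show "mvps_bounded_degree (power_sum_series k) \<and> mvps_symmetric (power_sum_series k)"
    by (auto simp: mvps_bounded_degree_def mvps_symmetric_def power_sum_series.rep_eq)
qed

text \<open>
  The generating function \<open>\<Sum>\<^sub>k e\<^sub>k z\<^sup>k = \<Prod>\<^sub>i (1 + x\<^sub>i z)\<close>: each coefficient of the infinite product is
  determined by finitely many factors.
\<close>

lemma mvps_var_mult:
  "mcoeff (mvps_var i * f) m = (if i \<in># m then mcoeff f (m - {#i#}) else 0)"
proof -
  let ?h = "\<lambda>(k, l). (if k = {#i#} then 1 else 0) * mcoeff f l"
  have "mcoeff (mvps_var i * f) m = sum ?h {(k, l). k + l = m}"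
    by (simp add: times_mvps.rep_eq mvps_var.rep_eq)
  also have "\<dots> = sum ?h (if i \<in># m then {({#i#}, m - {#i#})} else {})"
    by (rule sum.mono_neutral_right) (auto simp: finite_msplit split: if_splits)
  finally show ?thesis by simp
qed

lemma coeff_prod_elem_sf:
  "mcoeff (coeff (\<Prod>i<n. [:1, mvps_var i:]) k) m =
     (if set_mset m \<subseteq> {..<n} then mcoeff (elem_sf_series k) m else 0)"
proof (induction n arbitrary: k m)
  case 0
  then show ?case
    by (auto simp: elem_sf_series.rep_eq zero_mvps.rep_eq one_mvps.rep_eq coeff_1)
next
  case (Suc n)
  let ?P = "\<Prod>i<n. [:1, mvps_var i:]"
  have step: "coeff (\<Prod>i<Suc n. [:1, mvps_var i:]) k =
      coeff ?P k + (case k of 0 \<Rightarrow> 0 | Suc k' \<Rightarrow> mvps_var n * coeff ?P k')"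
    by (simp add: mult.commute[of ?P] coeff_pCons split: nat.split)
  show ?case
  proof (cases "n \<in># m")
    case False
    then have "set_mset m \<subseteq> {..<Suc n} \<longleftrightarrow> set_mset m \<subseteq> {..<n}"
      by (auto simp: less_Suc_eq)
    then show ?thesis using False
      unfolding step by (simp add: plus_mvps.rep_eq zero_mvps.rep_eq mvps_var_mult Suc split: nat.split)
  next
    case True
    then obtain m' where m: "m = add_mset n m'" by (metis mset_add)
    have sq: "(\<forall>i. count m i \<le> 1) \<longleftrightarrow> (\<forall>i. count m' i \<le> 1) \<and> n \<notin># m'"
      by (auto simp: m not_in_iff le_Suc_eq split: if_splits)
    have "set_mset m \<subseteq> {..<Suc n} \<and> n \<notin># m' \<longleftrightarrow> set_mset m' \<subseteq> {..<n}"
      by (auto simp: m less_Suc_eq)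
    then show ?thesis using sq
      unfolding step by (auto simp: m plus_mvps.rep_eq zero_mvps.rep_eq mvps_var_mult Suc
          elem_sf_series.rep_eq split: nat.split)
  qed
qed


section \<open>Schroeder paths\<close>

datatype step = Up | Diag | Right

fun step_between :: "nat \<times> nat \<Rightarrow> nat \<times> nat \<Rightarrow> step option" where
  "step_between (u, v) (u', v') =
     (if (u', v') = (u, v + 1) then Some Up
      else if (u', v') = (u + 1, v + 1) then Some Diag
      else if (u', v') = (u + 1, v) then Some Right
      else None)"

definition schroeder_paths :: "nat \<Rightarrow> nat \<Rightarrow> (nat \<times> nat) list set" where
  "schroeder_paths m n =
     {\<alpha>. \<alpha> \<noteq> [] \<and> hd \<alpha> = (0, 0) \<and> last \<alpha> = (m, n)
        \<and> (\<forall>(u, v) \<in> set \<alpha>. int m * int v - int n * int u \<ge> 0)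
        \<and> successively (\<lambda>P Q. step_between P Q \<noteq> None) \<alpha>}"

definition path_steps :: "(nat \<times> nat) list \<Rightarrow> step list" where
  "path_steps \<alpha> = map2 (\<lambda>P Q. the (step_between P Q)) (butlast \<alpha>) (tl \<alpha>)"

lemma length_dropWhile_less [termination_simp]: "length (dropWhile P xs) < Suc (length xs)"
  by (simp add: le_imp_less_Suc length_dropWhile_le)

fun riser_lengths :: "step list \<Rightarrow> nat list" where
  "riser_lengths [] = []"
| "riser_lengths (s # ss) =
     (if s = Up
      then length (takeWhile (\<lambda>t. t = Up) (s # ss)) # riser_lengths (dropWhile (\<lambda>t. t = Up) ss)
      else riser_lengths ss)"

definition path_risers :: "(nat \<times> nat) list \<Rightarrow> nat list" where
  "path_risers \<alpha> = riser_lengths (path_steps \<alpha>)"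

definition path_diag :: "(nat \<times> nat) list \<Rightarrow> nat" where
  "path_diag \<alpha> = count_list (path_steps \<alpha>) Diag"

definition path_weight :: "(nat \<times> nat) list \<Rightarrow> symfun" where
  "path_weight \<alpha> = prod_list (map elem_sf (path_risers \<alpha>))"

text \<open>The polynomial indeterminate of \<^typ>\<open>symfun poly\<close> plays the role of \<open>y\<close>.\<close>

definition schroeder_enum :: "nat \<Rightarrow> nat \<Rightarrow> symfun poly" where
  "schroeder_enum m n = (\<Sum>\<alpha> \<in> schroeder_paths m n. monom (path_weight \<alpha>) (path_diag \<alpha>))"

lemma schroeder_paths_bounded:
  "schroeder_paths m n \<subseteq> {\<alpha>. set \<alpha> \<subseteq> {..m} \<times> {..n} \<and> length \<alpha> \<le> m + n + 1}"
proof -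
  let ?succ = "successively (\<lambda>P Q. step_between P Q \<noteq> None)"
  have mono_step: "fst P \<le> fst Q \<and> snd P \<le> snd Q \<and> fst P + snd P < fst Q + snd Q"
    if "step_between P Q \<noteq> None" for P Q
    using that by (cases P; cases Q) (auto split: if_splits)
  have mono: "\<forall>P \<in> set \<alpha>. fst P \<le> fst (last \<alpha>) \<and> snd P \<le> snd (last \<alpha>)" if "?succ \<alpha>" for \<alpha>
    using that
  proof (induction \<alpha> rule: induct_list012)
    case (3 P Q \<alpha>)
    then have "step_between P Q \<noteq> None" "?succ (Q # \<alpha>)"
      by (simp_all only: successively.simps not_False_eq_True)
    then show ?case
      using "3.IH"(2) mono_step[of P Q] by fastforce
  qed auto
  have len: "length \<alpha> + fst (hd \<alpha>) + snd (hd \<alpha>) \<le> fst (last \<alpha>) + snd (last \<alpha>) + 1"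
    if "?succ \<alpha>" "\<alpha> \<noteq> []" for \<alpha>
    using that
  proof (induction \<alpha> rule: induct_list012)
    case (3 P Q \<alpha>)
    then have "step_between P Q \<noteq> None" "?succ (Q # \<alpha>)"
      by (simp_all only: successively.simps not_False_eq_True)
    then show ?case
      using "3.IH"(2) mono_step[of P Q] by auto
  qed auto
  show ?thesis
  proof
    fix \<alpha> assume "\<alpha> \<in> schroeder_paths m n"
    then have *: "\<alpha> \<noteq> []" "hd \<alpha> = (0, 0)" "last \<alpha> = (m, n)" "?succ \<alpha>"
      by (auto simp: schroeder_paths_def)
    then show "\<alpha> \<in> {\<alpha>. set \<alpha> \<subseteq> {..m} \<times> {..n} \<and> length \<alpha> \<le> m + n + 1}"
      using mono[OF *(4)] len[OF *(4,1)] by auto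
  qed
qed

lemma finite_schroeder_paths: "finite (schroeder_paths m n)"
  by (rule finite_subset[OF schroeder_paths_bounded])
    (intro finite_lists_length_le finite_cartesian_product finite_atMost)

lemma schroeder_enum_0_0: "schroeder_enum 0 0 = 1"
proof -
  have "\<alpha> = [(0, 0)]" if "\<alpha> \<in> schroeder_paths 0 0" for \<alpha>
    using that schroeder_paths_bounded[of 0 0]
    by (cases \<alpha>) (auto simp: schroeder_paths_def)
  then have "schroeder_paths 0 0 = {[(0, 0)]}"
    by (auto simp: schroeder_paths_def)
  then show ?thesis
    by (simp add: schroeder_enum_def path_weight_def path_risers_def path_diag_def path_steps_def
        flip: one_pCons monom_0)
qed


section \<open>Plethystic evaluation and the exponential\<close>

definition partitions :: "nat \<Rightarrow> nat multiset set" where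
  "partitions n = {\<nu>. 0 \<notin># \<nu> \<and> sum_mset \<nu> = n}"

lemma finite_partitions: "finite (partitions n)"
proof -
  have len: "size \<nu> \<le> sum_mset \<nu>" if "0 \<notin># \<nu>" for \<nu> :: "nat multiset"
    using that by (induction \<nu>) auto
  have "partitions n \<subseteq> mset ` {xs. set xs \<subseteq> {..n} \<and> length xs \<le> n}"
  proof
    fix \<nu> assume \<nu>: "\<nu> \<in> partitions n"
    obtain xs where xs: "mset xs = \<nu>" using ex_mset by blast
    have "set xs \<subseteq> {..n}"
    proof
      fix x assume "x \<in> set xs"
      then have "x \<in># \<nu>" using xs by auto
      then obtain \<nu>' where "\<nu> = add_mset x \<nu>'" by (metis mset_add)
      then show "x \<in> {..n}" using \<nu> by (auto simp: partitions_def)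
    qed
    moreover have "length xs \<le> n" using len[of \<nu>] \<nu> xs by (auto simp: partitions_def)
    ultimately show "\<nu> \<in> mset ` {xs. set xs \<subseteq> {..n} \<and> length xs \<le> n}" using xs by blast
  qed
  then show ?thesis by (rule finite_subset) (intro finite_imageI finite_lists_length_le finite_atMost)
qed

definition zee :: "nat multiset \<Rightarrow> nat" where
  "zee \<nu> = (\<Prod>i \<in> set_mset \<nu>. i ^ count \<nu> i * fact (count \<nu> i))"

text \<open>
  \<open>elem_pleth n N\<close> is \<open>e\<^sub>n[N(x + y)]\<close>, from \<open>p\<^sub>i[N(x + y)] = N (p\<^sub>i(x) + y\<^sup>i)\<close> and the power sum
  expansion of \<open>e\<^sub>n\<close>. The truncated subtraction is harmless, as a partition of \<open>n\<close> has at most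
  \<open>n\<close> parts.
\<close>

definition elem_pleth :: "nat \<Rightarrow> nat \<Rightarrow> symfun poly" where
  "elem_pleth n N =
     (\<Sum>\<nu> \<in> partitions n.
        smult (sf_const ((- 1) ^ (n - size \<nu>) * of_nat N ^ size \<nu> / of_nat (zee \<nu>)))
          (\<Prod>i \<in># \<nu>. [:power_sum i:] + monom 1 i))"

text \<open>
  The library's \<open>fps_exp\<close> needs coefficients in a field, hence the exponential series over the
  \<open>\<rat>\<close>-algebra of coefficients. The composition is the usual one only if \<open>F\<close> has no constant term.
\<close>

definition symfun_fps_exp :: "symfun poly fps \<Rightarrow> symfun poly fps" where
  "symfun_fps_exp F = Abs_fps (\<lambda>k. [:sf_const (1 / fact k):]) oo F"

end

theory Submission
  imports Defs
begin

text \<open>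
  A Schroeder path is determined by its columns: in each column it first goes up by some \<open>k \<ge> 0\<close>
  and then leaves by a right or a diagonal step. A column contributes the factor \<open>e\<^sub>k\<close>, respectively
  \<open>e\<^sub>k y\<close>, to the weight, and it gains the height \<open>k\<close>, respectively \<open>k + 1\<close>. So the columns of
  height \<open>h\<close> have as total weight the coefficient of \<open>w\<^sup>h\<close> in
  \<open>G(w) = (1 + y w) \<Prod>\<^sub>i (1 + x\<^sub>i w)\<close>. A path to \<open>(ad, bd)\<close> is then
  a sequence of \<open>ad\<close> columns of total height \<open>bd\<close> which, as a walk with a step \<open>a h - b\<close> for each
  column of height \<open>h\<close>, never becomes negative: an excursion. Dropping this restriction gives the
  bridges, the walks from \<open>0\<close> to \<open>0\<close>. The bridges of length \<open>ja\<close> have total weight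
  \<open>[w\<^sup>j\<^sup>b] G\<^sup>j\<^sup>a\<close>, and this is \<open>e\<^sub>j\<^sub>b[ja(x + y)]\<close>. As \<open>a\<close> and \<open>b\<close> are coprime, there are no bridges of
  other lengths.

  The proposition thus compares excursions with bridges. Let \<open>S\<^sub>n\<close> and \<open>T\<^sub>n\<close> be the total weights of the
  excursions and bridges of length \<open>n\<close>. Taking logarithmic derivatives, the claimed exponential
  formula becomes \<open>n S\<^sub>n = \<Sum>\<^sub>j T\<^sub>j S\<^sub>n\<^sub>-\<^sub>j\<close>, which has a bijective proof
  (\<open>excursions_bridges_recurrence\<close>). Mark one of the \<open>n\<close> steps of an excursion and cut at the last
  zero before it. The left part is an excursion of length \<open>n - j\<close>; the right part, rotated so
  that it starts at the marked step, is a bridge of length \<open>j\<close>. The bridge determines the rotation,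
  as the marked step starts before the first return of the right part to \<open>0\<close>: the old starting point is the last minimum of
  the bridge.

  The identification of \<open>[w\<^sup>n] G\<^sup>N\<close> with the sum over partitions that defines \<open>e\<^sub>n[N(x + y)]\<close>
  (\<open>elem_pleth_generating_function\<close>) also goes by logarithmic derivatives: for the power series in \<open>w\<close>
  with the partition sums as coefficients they are found by removing one part from a partition, and
  for \<open>G\<close> by Newton's identity, applied to the factor with the variables \<open>x\<close>. Every time, a recurrence \<open>n F\<^sub>n = \<Sum>\<^sub>i C\<^sub>i F\<^sub>n\<^sub>-\<^sub>i\<close> has only one solution
  for a given \<open>F\<^sub>0\<close>, since the positive integers are invertible in the ring of coefficients.
\<close>

unbundle fps_syntax

section \<open>Logarithmic derivatives over an algebra over the rationals\<close>

lemma fps_X_mult_deriv_nth: "(fps_X * fps_deriv F) $ n = of_nat n * F $ n"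
  by (cases n) auto

text \<open>
  The embedding of the rational numbers into a commutative algebra over them. The coefficient rings
  \<open>\<rat> \<otimes> \<Lambda>\<close> and \<open>\<rat> \<otimes> \<Lambda>[y]\<close> are not fields, so division by integers is multiplication by images under
  this map.
\<close>

locale rat_scalars =
  fixes \<phi> :: "rat \<Rightarrow> 'r::comm_ring_1"
  assumes scalar_one [simp]: "\<phi> 1 = 1"
    and scalar_add: "\<phi> (x + y) = \<phi> x + \<phi> y"
    and scalar_mult: "\<phi> (x * y) = \<phi> x * \<phi> y"
begin

lemma scalar_zero [simp]: "\<phi> 0 = 0"
  using scalar_add[of 0 0] by simp

lemma scalar_of_nat [simp]: "\<phi> (of_nat n) = of_nat n"
  by (induction n) (simp_all add: scalar_add)

lemma scalar_minus: "\<phi> (- x) = - \<phi> x"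
  using scalar_add[of x "- x"] by (simp add: eq_neg_iff_add_eq_0 add.commute)

lemma scalar_power: "\<phi> (x ^ n) = \<phi> x ^ n"
  by (induction n) (simp_all add: scalar_mult)

lemma of_nat_mult_cancel:
  fixes x y :: 'r
  assumes "of_nat n * x = of_nat n * y" "n > 0"
  shows "x = y"
proof -
  have "\<phi> (1 / of_nat n) * of_nat n = 1"
    using assms(2) by (simp flip: scalar_of_nat scalar_mult)
  then show ?thesis
    using arg_cong[OF assms(1), of "\<lambda>x. \<phi> (1 / of_nat n) * x"]
    by (simp flip: mult.assoc)
qed

text \<open>
  The equation says that \<open>n F\<^sub>n = \<Sum>\<^sub>i C\<^sub>i F\<^sub>n\<^sub>-\<^sub>i\<close>, and the right side has only earlier coefficients
  of \<open>F\<close> because \<open>C\<^sub>0 = 0\<close>.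
\<close>

lemma log_derivative_unique:
  fixes F H C :: "'r fps"
  assumes F: "fps_X * fps_deriv F = C * F" and H: "fps_X * fps_deriv H = C * H"
    and C: "C $ 0 = 0" and init: "F $ 0 = H $ 0"
  shows "F = H"
proof (rule fps_ext)
  fix n show "F $ n = H $ n"
  proof (induction n rule: less_induct)
    case (less n)
    show ?case
    proof (cases "n = 0")
      case False
      have "of_nat n * F $ n = (\<Sum>i=0..n. C $ i * F $ (n - i))"
        unfolding fps_X_mult_deriv_nth[symmetric] F by (rule fps_mult_nth)
      also have "\<dots> = (\<Sum>i=0..n. C $ i * H $ (n - i))"
        using less C False by (intro sum.cong) (metis (no_types) diff_less mult_zero_left neq0_conv)+
      also have "\<dots> = of_nat n * H $ n"
        unfolding fps_X_mult_deriv_nth[symmetric] H by (rule fps_mult_nth[symmetric])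
      finally show ?thesis using False of_nat_mult_cancel by blast
    qed (use init in simp)
  qed
qed

text \<open>
  The chain rule for the exponential series, by differentiating the powers of \<open>F\<close> term by term.
\<close>

lemma log_derivative_exp:
  fixes F :: "'r fps"
  assumes F: "F $ 0 = 0"
  defines "H \<equiv> Abs_fps (\<lambda>k. \<phi> (1 / fact k)) oo F"
  shows "fps_X * fps_deriv H = (fps_X * fps_deriv F) * H"
proof -
  let ?c = "\<lambda>k. \<phi> (1 / fact k)"
  have small: "F ^ i $ k = 0" if "k < i" for i k
    using startsby_zero_power_prefix[OF F] that by blast
  \<comment> \<open>A common upper summation bound for all the coefficients that occur below.\<close>
  have H_nth: "H $ n = (\<Sum>i=0..N. ?c i * F ^ i $ n)" if "n \<le> N" for n N
    unfolding H_def fps_compose_nth fps_nth_Abs_fps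
    by (rule sum.mono_neutral_left) (use that small in auto)
  have fact: "?c (Suc i) * of_nat (Suc i) = ?c i" for i
  proof -
    have "(1 / fact (Suc i) * of_nat (Suc i) :: rat) = 1 / fact i" by (simp add: fact_Suc del: of_nat_Suc)
    then show ?thesis by (simp only: scalar_mult[symmetric] scalar_of_nat[symmetric])
  qed
  have "fps_deriv H $ n = (fps_deriv F * H) $ n" for n
  proof -
    have "fps_deriv H $ n = (\<Sum>i=0..Suc n. ?c i * fps_deriv (F ^ i) $ n)"
      by (simp add: H_nth[of _ "Suc n"] sum_distrib_left mult_ac del: of_nat_Suc sum.cl_ivl_Suc)
    also have "\<dots> = (\<Sum>i=0..n. ?c (Suc i) * fps_deriv (F ^ Suc i) $ n)"
      by (subst sum.atLeast0_atMost_Suc_shift) (simp del: power_Suc fps_deriv_mult fps_deriv_nth fact_Suc of_nat_Suc)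
    also have "\<dots> = (\<Sum>i=0..n. ?c i * (fps_deriv F * F ^ i) $ n)"
    proof (intro sum.cong refl)
      fix i
      have "fps_deriv (F ^ Suc i) = of_nat (Suc i) * (fps_deriv F * F ^ i)"
        by (induction i) (simp_all add: algebra_simps)
      then have "?c (Suc i) * fps_deriv (F ^ Suc i) $ n =
          ?c (Suc i) * of_nat (Suc i) * (fps_deriv F * F ^ i) $ n"
        by (simp only: fps_of_nat[symmetric] fps_mult_left_const_nth mult.assoc)
      then show "?c (Suc i) * fps_deriv (F ^ Suc i) $ n = ?c i * (fps_deriv F * F ^ i) $ n"
        unfolding fact .
    qed
    also have "\<dots> = (\<Sum>i=0..n. \<Sum>j=0..n. ?c i * (fps_deriv F $ j * F ^ i $ (n - j)))"
      by (simp only: fps_mult_nth sum_distrib_left)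
    also have "\<dots> = (\<Sum>j=0..n. fps_deriv F $ j * (\<Sum>i=0..n. ?c i * F ^ i $ (n - j)))"
      by (subst sum.swap) (simp add: sum_distrib_left mult_ac)
    also have "\<dots> = (fps_deriv F * H) $ n"
      by (simp only: fps_mult_nth) (intro sum.cong refl, simp only: H_nth[of _ n] diff_le_self)
    finally show ?thesis .
  qed
  then have "fps_deriv H = fps_deriv F * H" by (rule fps_ext)
  then show ?thesis by (simp add: mult.assoc)
qed

text \<open>
  The coefficient of \<open>c\<^sub>\<nu>\<close> in the cycle index of the symmetric group, times \<open>c\<^sub>\<nu>\<close>, where
  \<open>c\<^sub>\<nu>\<close> is the product of \<open>c\<^sub>i\<close> over the parts \<open>i\<close> of \<open>\<nu>\<close>.
\<close>

definition cycle_index_term :: "(nat \<Rightarrow> 'r) \<Rightarrow> nat multiset \<Rightarrow> 'r" where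
  "cycle_index_term c \<nu> = \<phi> (1 / of_nat (zee \<nu>)) * (\<Prod>i\<in>#\<nu>. c i)"

lemma zee_add_mset: "zee (add_mset i \<nu>) = zee \<nu> * (i * Suc (count \<nu> i))"
proof -
  let ?f = "\<lambda>\<nu> k. k ^ count \<nu> k * fact (count \<nu> k) :: nat"
  have zee: "zee \<mu> = (\<Prod>k\<in>insert i (set_mset \<nu>). ?f \<mu> k)"
    if "set_mset \<mu> \<subseteq> insert i (set_mset \<nu>)" for \<mu>
    unfolding zee_def by (rule prod.mono_neutral_left) (use that in \<open>auto simp: not_in_iff\<close>)
  have rest: "(\<Prod>k\<in>set_mset \<nu> - {i}. ?f (add_mset i \<nu>) k) = (\<Prod>k\<in>set_mset \<nu> - {i}. ?f \<nu> k)"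
    by (rule prod.cong) auto
  show ?thesis
    by (simp add: zee[of "add_mset i \<nu>"] zee[of \<nu>] prod.insert_remove rest subset_insertI algebra_simps)
qed

lemma sum_mset_eq_sum_count: "(\<Sum>i\<in>set_mset M. i * count M i) = (sum_mset M :: nat)"
proof -
  have "(\<Sum>i\<in>A. i * count M i) = sum_mset M" if "finite A" "set_mset M \<subseteq> A" for A
    using that
  proof (induction M)
    case (add x M)
    have "(\<Sum>i\<in>A. i * count (add_mset x M) i) = (\<Sum>i\<in>A. i * count M i + (if i = x then x else 0))"
      by (rule sum.cong) auto
    then show ?case using add by (simp add: sum.distrib)
  qed simp
  from this[of "set_mset M"] show ?thesis by simp
qed

text \<open>
  The power series is \<open>exp (\<Sum>\<^sub>i c\<^sub>i w\<^sup>i / i)\<close>. Its logarithmic derivative comes from a double count: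
  write \<open>n\<close> as the sum of \<open>i d\<^sub>i\<close> over the distinct parts \<open>i\<close> of \<open>\<nu>\<close>, with \<open>d\<^sub>i\<close> their
  multiplicities. The factor \<open>i d\<^sub>i\<close> turns \<open>1 / z\<^sub>\<nu>\<close> into \<open>1 / z\<^sub>\<mu>\<close>, where \<open>\<mu>\<close> is \<open>\<nu>\<close> with one part
  \<open>i\<close> removed, a partition of \<open>n - i\<close>.
\<close>

lemma log_derivative_cycle_index:
  "fps_X * fps_deriv (Abs_fps (\<lambda>n. \<Sum>\<nu>\<in>partitions n. cycle_index_term c \<nu>)) =
     Abs_fps (\<lambda>i. if i = 0 then 0 else c i) * Abs_fps (\<lambda>n. \<Sum>\<nu>\<in>partitions n. cycle_index_term c \<nu>)"
proof (rule fps_ext)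
  fix n
  let ?t = "cycle_index_term c"
  have weight: "of_nat (i * Suc (count \<nu> i)) * ?t (add_mset i \<nu>) = c i * ?t \<nu>" if "i > 0" for i \<nu>
  proof -
    have "of_nat (i * Suc (count \<nu> i)) * \<phi> (1 / of_nat (zee (add_mset i \<nu>))) = \<phi> (1 / of_nat (zee \<nu>))"
      unfolding scalar_of_nat[symmetric] scalar_mult[symmetric] zee_add_mset
      using that by (simp del: of_nat_Suc mult_Suc_right of_nat_mult add: of_nat_mult[where 'a=rat, of "zee \<nu>"])
    then show ?thesis unfolding cycle_index_term_def by (simp add: mult_ac)
  qed
  have count: "(\<Sum>i\<in>set_mset \<nu>. i * count \<nu> i) = n" if "\<nu> \<in> partitions n" for \<nu>
    using that by (simp add: partitions_def sum_mset_eq_sum_count)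
  have "of_nat n * (\<Sum>\<nu>\<in>partitions n. ?t \<nu>) =
      (\<Sum>\<nu>\<in>partitions n. of_nat (\<Sum>i\<in>set_mset \<nu>. i * count \<nu> i) * ?t \<nu>)"
    by (simp add: sum_distrib_left count)
  also have "\<dots> = (\<Sum>\<nu>\<in>partitions n. \<Sum>i\<in>set_mset \<nu>. of_nat (i * count \<nu> i) * ?t \<nu>)"
    by (simp only: of_nat_sum sum_distrib_right)
  also have "\<dots> = (\<Sum>(\<nu>, i)\<in>Sigma (partitions n) set_mset. of_nat (i * count \<nu> i) * ?t \<nu>)"
    by (rule sum.Sigma) (auto simp: finite_partitions)
  also have "\<dots> = (\<Sum>(i, \<nu>)\<in>Sigma {1..n} (\<lambda>i. partitions (n - i)). c i * ?t \<nu>)"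
  proof (rule sum.reindex_bij_witness[of _ "\<lambda>(i, \<nu>). (add_mset i \<nu>, i)" "\<lambda>(\<nu>, i). (i, \<nu> - {#i#})"])
    fix x assume "x \<in> Sigma (partitions n) set_mset"
    then obtain \<mu> i where "x = (\<mu>, i)" "\<mu> \<in> partitions n" "i \<in># \<mu>"
      by (cases x) auto
    moreover then obtain \<nu> where "\<mu> = add_mset i \<nu>" by (metis mset_add)
    ultimately have x: "x = (add_mset i \<nu>, i)" and \<nu>: "add_mset i \<nu> \<in> partitions n" by auto
    then show "(case case x of (\<nu>, i) \<Rightarrow> (i, \<nu> - {#i#}) of (i, \<nu>) \<Rightarrow> (add_mset i \<nu>, i)) = x" by simp
    show "(case x of (\<nu>, i) \<Rightarrow> (i, \<nu> - {#i#})) \<in> Sigma {1..n} (\<lambda>i. partitions (n - i))"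
      using \<nu> by (auto simp: x partitions_def Suc_le_eq)
    have "i > 0" using \<nu> by (auto simp: partitions_def)
    from weight[OF this, of \<nu>]
    show "(case case x of (\<nu>, i) \<Rightarrow> (i, \<nu> - {#i#}) of (i, \<nu>) \<Rightarrow> c i * ?t \<nu>) =
        (case x of (\<nu>, i) \<Rightarrow> of_nat (i * count \<nu> i) * ?t \<nu>)"
      by (simp add: x algebra_simps)
  qed (auto simp: partitions_def)
  also have "\<dots> = (\<Sum>i=1..n. c i * (\<Sum>\<nu>\<in>partitions (n - i). ?t \<nu>))"
    by (subst sum.Sigma[symmetric]) (auto simp: finite_partitions sum_distrib_left)
  also have "\<dots> = (\<Sum>i=0..n. (if i = 0 then 0 else c i) * (\<Sum>\<nu>\<in>partitions (n - i). ?t \<nu>))"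
    by (rule sum.mono_neutral_cong_left) auto
  finally show "(fps_X * fps_deriv (Abs_fps (\<lambda>n. \<Sum>\<nu>\<in>partitions n. ?t \<nu>))) $ n =
    (Abs_fps (\<lambda>i. if i = 0 then 0 else c i) * Abs_fps (\<lambda>n. \<Sum>\<nu>\<in>partitions n. ?t \<nu>)) $ n"
    unfolding fps_X_mult_deriv_nth by (simp only: fps_mult_nth fps_nth_Abs_fps)
qed

end


lemma log_derivative_mult:
  fixes F G :: "'r::comm_ring_1 fps"
  assumes "fps_X * fps_deriv F = C * F" "fps_X * fps_deriv G = D * G"
  shows "fps_X * fps_deriv (F * G) = (C + D) * (F * G)"
  using arg_cong[OF assms(1), of "\<lambda>x. x * G"] arg_cong[OF assms(2), of "\<lambda>x. F * x"]
  by (simp add: algebra_simps)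

lemma log_derivative_power:
  fixes F :: "'r::comm_ring_1 fps"
  assumes "fps_X * fps_deriv F = C * F"
  shows "fps_X * fps_deriv (F ^ N) = (of_nat N * C) * F ^ N"
proof (induction N)
  case (Suc N)
  from log_derivative_mult[OF assms Suc] show ?case by (simp add: algebra_simps)
qed simp


section \<open>Newton's identity\<close>

lemma mcoeff_sum: "mcoeff (sum f A) m = (\<Sum>x\<in>A. mcoeff (f x) m)"
  by (induction A rule: infinite_finite_induct) (simp_all add: zero_mvps.rep_eq plus_mvps.rep_eq)

lemma mcoeff_of_nat_mult: "mcoeff (of_nat n * f) m = of_nat n * mcoeff f m"
  by (induction n) (simp_all add: zero_mvps.rep_eq plus_mvps.rep_eq distrib_right)

lemma mcoeff_sign_mult: "mcoeff ((- 1) ^ n * f) m = (- 1) ^ n * mcoeff f m"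
  by (induction n) (simp_all add: uminus_mvps.rep_eq)

text \<open>
  A product with \<open>p\<^sub>k\<close> collects the ways to split off a \<open>k\<close>-th power of a variable from \<open>m\<close>. For
  \<open>k = 0\<close> the variable would not be determined by its power.
\<close>

lemma mcoeff_power_sum_mult:
  assumes "k > 0"
  shows "mcoeff (power_sum_series k * f) m =
    (\<Sum>i \<in> {i \<in> set_mset m. k \<le> count m i}. mcoeff f (m - replicate_mset k i))"
proof -
  let ?A = "{i \<in> set_mset m. k \<le> count m i}"
  have "mcoeff (power_sum_series k * f) m =
      (\<Sum>(p, l) \<in> {(p, l). p + l = m}. mcoeff (power_sum_series k) p * mcoeff f l)"
    by (simp add: times_mvps.rep_eq)
  also have "\<dots> = (\<Sum>(p, l) \<in> (\<lambda>i. (replicate_mset k i, m - replicate_mset k i)) ` ?A.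
      mcoeff (power_sum_series k) p * mcoeff f l)"
  proof (rule sum.mono_neutral_right)
    show "(\<lambda>i. (replicate_mset k i, m - replicate_mset k i)) ` ?A \<subseteq> {(p, l). p + l = m}"
      by (auto simp: count_le_replicate_mset_subset_eq)
    show "\<forall>x \<in> {(p, l). p + l = m} - (\<lambda>i. (replicate_mset k i, m - replicate_mset k i)) ` ?A.
        (case x of (p, l) \<Rightarrow> mcoeff (power_sum_series k) p * mcoeff f l) = 0"
    proof clarify
      fix p l assume m: "m = p + l" "(p, l) \<notin> (\<lambda>i. (replicate_mset k i, p + l - replicate_mset k i)) ` {i \<in> set_mset (p + l). k \<le> count (p + l) i}"
      then have "p \<noteq> replicate_mset k i" for i using m(2) assms by (force simp: image_iff)
      then show "mcoeff (power_sum_series k) p * mcoeff f l = 0"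
        by (simp add: power_sum_series.rep_eq)
    qed
  qed (rule finite_msplit)
  also have "\<dots> = (\<Sum>i \<in> ?A. mcoeff (power_sum_series k) (replicate_mset k i) * mcoeff f (m - replicate_mset k i))"
    by (subst sum.reindex) (use assms in \<open>auto simp: inj_on_def replicate_mset_eq_iff\<close>)
  also have "\<dots> = (\<Sum>i \<in> ?A. mcoeff f (m - replicate_mset k i))"
    by (rule sum.cong) (auto simp: power_sum_series.rep_eq)
  finally show ?thesis .
qed

text \<open>
  Let \<open>x\<close> have exponent \<open>c \<ge> 1\<close> in \<open>m\<close>. Dividing \<open>m\<close> by \<open>x\<^sup>k\<close> with \<open>k \<le> c\<close> leaves a squarefree
  monomial only if \<open>k\<close> is \<open>c - 1\<close> or \<open>c\<close>, and then for both. If \<open>c \<ge> 2\<close> these two terms cancel; if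
  \<open>c = 1\<close> only \<open>k = c\<close> is in the range of the sum.
\<close>

lemma alternating_squarefree:
  fixes m :: "nat multiset"
  assumes x: "x \<in># m"
  shows "(\<Sum>k=1..count m x. (- 1) ^ (k - 1) * (if \<forall>i. count (m - replicate_mset k x) i \<le> 1 then 1 else 0))
    = (if \<forall>i. count m i \<le> 1 then 1 else 0 :: rat)"
proof -
  let ?q = "\<forall>i. i \<noteq> x \<longrightarrow> count m i \<le> 1"
  have sq: "(\<forall>i. count (m - replicate_mset k x) i \<le> 1) \<longleftrightarrow> ?q \<and> count m x \<le> Suc k" for k
    by (auto simp: le_diff_conv)
  have sqm: "(\<forall>i. count m i \<le> 1) \<longleftrightarrow> ?q \<and> count m x \<le> 1" by auto
  obtain c where c: "count m x = Suc c" using x by (metis count_eq_zero_iff not0_implies_Suc)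
  show ?thesis unfolding sq sqm c
    by (cases c) (auto simp: sum.atLeast1_atMost_eq if_distrib cong: if_cong)
qed

text \<open>
  At a monomial \<open>m\<close> of degree \<open>n\<close>, the right side is a double sum over the variables \<open>x\<close> of \<open>m\<close> and the
  exponents \<open>k\<close>. Summing over \<open>k\<close> first, each of the variables contributes 1 if \<open>m\<close> is squarefree and 0
  otherwise; a squarefree \<open>m\<close> has \<open>n\<close> variables.
\<close>

theorem newton_identity_series:
  "of_nat n * elem_sf_series n = (\<Sum>k=1..n. (- 1) ^ (k - 1) * (power_sum_series k * elem_sf_series (n - k)))"
proof (rule mvps_eqI)
  fix m
  let ?sq = "\<lambda>m::nat multiset. if \<forall>i. count m i \<le> 1 then 1 else 0 :: rat"
  have "mcoeff (\<Sum>k=1..n. (- 1) ^ (k - 1) * (power_sum_series k * elem_sf_series (n - k))) m =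
     (\<Sum>k=1..n. (- 1) ^ (k - 1) * (\<Sum>i \<in> {i \<in> set_mset m. k \<le> count m i}. 
        mcoeff (elem_sf_series (n - k)) (m - replicate_mset k i)))"
    by (simp add: mcoeff_sum mcoeff_sign_mult mcoeff_power_sum_mult)
  also have "\<dots> = (\<Sum>k=1..n. \<Sum>i \<in> {i \<in> set_mset m. k \<le> count m i}. 
        if size m = n then (- 1) ^ (k - 1) * ?sq (m - replicate_mset k i) else 0)"
    unfolding sum_distrib_left
    by (intro sum.cong refl) (auto simp: elem_sf_series.rep_eq size_Diff_submset
        count_le_replicate_mset_subset_eq dest!: size_mset_mono)
  also have "\<dots> = (if size m = n then of_nat n * ?sq m else 0)"
  proof (cases "size m = n")
    case True
    have le: "count m i \<le> n" for i using True by (metis count_le_size)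
    have "(\<Sum>k=1..n. \<Sum>i \<in> {i \<in> set_mset m. k \<le> count m i}. (- 1) ^ (k - 1) * ?sq (m - replicate_mset k i))
       = (\<Sum>i \<in> set_mset m. \<Sum>k \<in> {k \<in> {1..n}. k \<le> count m i}. (- 1) ^ (k - 1) * ?sq (m - replicate_mset k i))"
      by (rule sum.swap_restrict) auto
    also have "\<dots> = (\<Sum>i \<in> set_mset m. ?sq m)"
    proof (intro sum.cong refl)
      fix i assume i: "i \<in># m"
      have "{k \<in> {1..n}. k \<le> count m i} = {1..count m i}" using le[of i] by auto
      then show "(\<Sum>k \<in> {k \<in> {1..n}. k \<le> count m i}. (- 1) ^ (k - 1) * ?sq (m - replicate_mset k i)) = ?sq m"
        using alternating_squarefree[OF i] by simp
    qed
    also have "\<dots> = of_nat n * ?sq m"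
    proof (cases "\<forall>i. count m i \<le> 1")
      case sq: True
      have "size m = (\<Sum>i\<in>set_mset m. count m i)" by (simp add: size_multiset_overloaded_eq)
      also have "\<dots> = (\<Sum>i\<in>set_mset m. 1)"
        using sq by (intro sum.cong refl) (metis count_greater_eq_one_iff le_antisym)
      finally show ?thesis using True sq by simp
    qed (simp only: if_False sum.neutral_const mult_zero_right)
    finally show ?thesis using True by simp
  qed simp
  also have "\<dots> = mcoeff (of_nat n * elem_sf_series n) m"
    by (simp add: mcoeff_of_nat_mult elem_sf_series.rep_eq)
  finally show "mcoeff (of_nat n * elem_sf_series n) m =
    mcoeff (\<Sum>k=1..n. (- 1) ^ (k - 1) * (power_sum_series k * elem_sf_series (n - k))) m" ..
qed

lemma mvps_of_symfun_sum: "mvps_of_symfun (sum f A) = (\<Sum>x\<in>A. mvps_of_symfun (f x))"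
  by (induction A rule: infinite_finite_induct) (simp_all add: zero_symfun.rep_eq plus_symfun.rep_eq)

lemma mvps_of_symfun_of_nat: "mvps_of_symfun (of_nat n) = of_nat n"
  by (induction n) (simp_all add: zero_symfun.rep_eq one_symfun.rep_eq plus_symfun.rep_eq)

lemma mvps_of_symfun_sign: "mvps_of_symfun ((- 1) ^ n) = (- 1) ^ n"
  by (induction n) (simp_all add: one_symfun.rep_eq uminus_symfun.rep_eq)

theorem newton_identity:
  "of_nat n * elem_sf n = (\<Sum>k=1..n. (- 1) ^ (k - 1) * (power_sum k * elem_sf (n - k)))"
proof -
  have "mvps_of_symfun (of_nat n * elem_sf n) =
      mvps_of_symfun (\<Sum>k=1..n. (- 1) ^ (k - 1) * (power_sum k * elem_sf (n - k)))"
    using newton_identity_series[of n]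
    by (simp add: mvps_of_symfun_sum mvps_of_symfun_of_nat mvps_of_symfun_sign times_symfun.rep_eq
        elem_sf.rep_eq power_sum.rep_eq)
  then show ?thesis by (simp add: mvps_of_symfun_inject)
qed

section \<open>Plethystic evaluation as a coefficient of a power\<close>

abbreviation scalar :: "rat \<Rightarrow> symfun poly" where
  "scalar c \<equiv> [:sf_const c:]"

lemma mvps_const_mult: "mcoeff (mvps_const c * f) m = c * mcoeff f m"
proof -
  let ?h = "\<lambda>(k :: nat multiset, l). (if k = {#} then c else 0) * mcoeff f l"
  have "mcoeff (mvps_const c * f) m = sum ?h {(k, l). k + l = m}"
    by (simp add: times_mvps.rep_eq mvps_const.rep_eq)
  also have "\<dots> = sum ?h {({#}, m)}"
    by (rule sum.mono_neutral_right) (auto simp: finite_msplit split: if_splits)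
  finally show ?thesis by simp
qed

interpretation scalar: rat_scalars scalar
proof
  have "sf_const 1 = 1"
    by transfer (rule mvps_eqI, simp add: one_mvps.rep_eq mvps_const.rep_eq)
  then show "scalar 1 = 1" by (simp add: one_pCons)
  fix x y
  have "sf_const (x + y) = sf_const x + sf_const y"
    by transfer (rule mvps_eqI, simp add: plus_mvps.rep_eq mvps_const.rep_eq)
  then show "scalar (x + y) = scalar x + scalar y" by simp
  have "sf_const (x * y) = sf_const x * sf_const y"
    by transfer (rule mvps_eqI, simp add: mvps_const_mult mvps_const.rep_eq)
  then show "scalar (x * y) = scalar x * scalar y" by simp
qed

lemma smult_sf_const: "smult (sf_const c) p = scalar c * p"
  by simp

definition elem_series :: "symfun poly fps" where
  "elem_series = Abs_fps (\<lambda>k. [:elem_sf k:])"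

text \<open>
  The factor \<open>1 + y w\<close> by which the extra variable \<open>y\<close> extends the product
  \<open>\<Prod>\<^sub>i (1 + x\<^sub>i w)\<close>.
\<close>

definition added_var_series :: "symfun poly fps" where
  "added_var_series = 1 + fps_const (monom 1 1) * fps_X"

lemma elem_sf_0: "elem_sf 0 = 1"
  by transfer (rule mvps_eqI, auto simp: elem_sf_series.rep_eq one_mvps.rep_eq)

lemma log_derivative_elem_series:
  "fps_X * fps_deriv elem_series =
     Abs_fps (\<lambda>k. if k = 0 then 0 else (- 1) ^ (k - 1) * [:power_sum k:]) * elem_series"
proof (rule fps_ext)
  fix n
  have poly: "[:(- 1) ^ k * c:] = (- 1) ^ k * [:c:]" for k and c :: symfun
    by (cases "even k") simp_all
  have poly_sum: "(\<Sum>x\<in>A. [:f x:]) = [:sum f A:]" for f :: "nat \<Rightarrow> symfun" and A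
    by (induction A rule: infinite_finite_induct) simp_all
  have "of_nat n * [:elem_sf n:] = [:of_nat n * elem_sf n:]"
    by (simp add: of_nat_poly)
  also have "\<dots> = (\<Sum>k=1..n. (- 1) ^ (k - 1) * ([:power_sum k:] * [:elem_sf (n - k):]))"
    unfolding newton_identity poly_sum[symmetric] poly by (simp add: mult.commute)
  also have "\<dots> = (\<Sum>k=0..n. (if k = 0 then 0 else (- 1) ^ (k - 1) * [:power_sum k:]) * [:elem_sf (n - k):])"
    by (rule sum.mono_neutral_cong_left) (auto simp: mult.assoc)
  finally show "(fps_X * fps_deriv elem_series) $ n =
      (Abs_fps (\<lambda>k. if k = 0 then 0 else (- 1) ^ (k - 1) * [:power_sum k:]) * elem_series) $ n"
    unfolding fps_X_mult_deriv_nth by (simp only: fps_mult_nth elem_series_def fps_nth_Abs_fps)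
qed

lemma log_derivative_added_var_series:
  "fps_X * fps_deriv added_var_series =
     Abs_fps (\<lambda>k. if k = 0 then 0 else (- 1) ^ (k - 1) * monom 1 k) * added_var_series"
proof (rule fps_ext)
  fix n
  have mon: "monom 1 (Suc k) = monom 1 1 * monom (1 :: symfun) k" for k
    by (simp add: mult_monom)
  consider "n = 0" | "n = 1" | k where "n = Suc (Suc k)" by (metis One_nat_def not0_implies_Suc)
  then show "(fps_X * fps_deriv added_var_series) $ n =
      (Abs_fps (\<lambda>k. if k = 0 then 0 else (- 1) ^ (k - 1) * monom 1 k) * added_var_series) $ n"
  proof cases
    case 3
    then show ?thesis
      unfolding fps_X_mult_deriv_nth using mon[of "Suc k"]
      by (simp add: added_var_series_def distrib_left mult.assoc[symmetric])
  qed (simp_all add: added_var_series_def distrib_left)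
qed

text \<open>
  The sign \<open>(-1)\<^sup>n\<^sup>-\<^sup>l\<close> and the power \<open>N\<^sup>l\<close>, where \<open>l\<close> is the number of parts of \<open>\<nu>\<close>, are
  multiplicative over the parts: a part \<open>i\<close> contributes \<open>(-1)\<^sup>i\<^sup>-\<^sup>1 N\<close>.
\<close>

lemma elem_pleth_eq_cycle_index:
  "elem_pleth n N = (\<Sum>\<nu>\<in>partitions n. scalar.cycle_index_term
     (\<lambda>i. of_nat N * ((- 1) ^ (i - 1) * ([:power_sum i:] + monom 1 i))) \<nu>)"
  unfolding elem_pleth_def
proof (intro sum.cong refl)
  fix \<nu> assume \<nu>: "\<nu> \<in> partitions n"
  let ?q = "\<lambda>i. [:power_sum i:] + monom 1 i"
  have size: "size \<nu> \<le> sum_mset \<nu>" if "0 \<notin># \<nu>" for \<nu> :: "nat multiset"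
    using that by (induction \<nu>) auto
  have "(\<Prod>i\<in>#\<nu>. of_nat N * ((- 1) ^ (i - 1) * ?q i)) =
      (- 1) ^ (sum_mset \<nu> - size \<nu>) * (of_nat N ^ size \<nu> * (\<Prod>i\<in>#\<nu>. ?q i))"
    if "0 \<notin># \<nu>" for \<nu>
    using that
  proof (induction \<nu>)
    case (add i \<nu>)
    let ?e = "sum_mset \<nu> - size \<nu>" and ?P = "\<Prod>i\<in>#\<nu>. ?q i"
    have e: "sum_mset (add_mset i \<nu>) - size (add_mset i \<nu>) = (i - 1) + ?e"
      using add.prems size[of \<nu>] by auto
    have "(\<Prod>i\<in>#\<nu>. of_nat N * ((- 1) ^ (i - 1) * ?q i)) = (- 1) ^ ?e * (of_nat N ^ size \<nu> * ?P)"
      using add by simp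
    then have "(\<Prod>i\<in>#add_mset i \<nu>. of_nat N * ((- 1) ^ (i - 1) * ?q i)) =
        of_nat N * ((- 1) ^ (i - 1) * ?q i) * ((- 1) ^ ?e * (of_nat N ^ size \<nu> * ?P))"
      by (simp only: image_mset_add_mset prod_mset.add_mset)
    also have "\<dots> = (- 1) ^ (i - 1) * (- 1) ^ ?e * (of_nat N * of_nat N ^ size \<nu> * (?q i * ?P))"
      by (simp only: mult_ac)
    finally show ?case
      unfolding e power_add by (simp only: size_add_mset power_Suc image_mset_add_mset prod_mset.add_mset)
  qed simp
  then have "(\<Prod>i\<in>#\<nu>. of_nat N * ((- 1) ^ (i - 1) * ?q i)) =
      (- 1) ^ (n - size \<nu>) * (of_nat N ^ size \<nu> * (\<Prod>i\<in>#\<nu>. ?q i))"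
    using \<nu> by (auto simp: partitions_def)
  moreover have "scalar ((- 1) ^ k * of_nat N ^ l / of_nat z) =
      scalar (1 / of_nat z) * ((- 1) ^ k * of_nat N ^ l)" for k l z
  proof -
    have "(- 1) ^ k * of_nat N ^ l / of_nat z = 1 / of_nat z * ((- 1) ^ k * of_nat N ^ l :: rat)"
      by simp
    then show ?thesis
      by (simp only: scalar.scalar_mult scalar.scalar_power scalar.scalar_minus scalar.scalar_one
          scalar.scalar_of_nat)
  qed
  ultimately show "smult (sf_const ((- 1) ^ (n - size \<nu>) * of_nat N ^ size \<nu> / of_nat (zee \<nu>)))
      (\<Prod>i\<in>#\<nu>. ?q i) = scalar.cycle_index_term (\<lambda>i. of_nat N * ((- 1) ^ (i - 1) * ?q i)) \<nu>"
    unfolding scalar.cycle_index_term_def smult_sf_const by (simp only: mult.assoc)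
qed

text \<open>
  Both sides have the constant term 1 and the logarithmic derivative
  \<open>N \<Sum>\<^sub>i (-1)\<^sup>i\<^sup>-\<^sup>1 (p\<^sub>i + y\<^sup>i) w\<^sup>i\<close>.
\<close>

theorem elem_pleth_generating_function:
  "Abs_fps (\<lambda>n. elem_pleth n N) = (elem_series * added_var_series) ^ N"
proof (rule scalar.log_derivative_unique)
  let ?c = "\<lambda>i. of_nat N * ((- 1) ^ (i - 1) * ([:power_sum i:] + monom 1 i))"
  let ?C = "Abs_fps (\<lambda>i. if i = 0 then 0 else ?c i)"
  show "fps_X * fps_deriv (Abs_fps (\<lambda>n. elem_pleth n N)) = ?C * Abs_fps (\<lambda>n. elem_pleth n N)"
    unfolding elem_pleth_eq_cycle_index by (rule scalar.log_derivative_cycle_index)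
  have "?C = of_nat N * (Abs_fps (\<lambda>k. if k = 0 then 0 else (- 1) ^ (k - 1) * [:power_sum k:]) +
      Abs_fps (\<lambda>k. if k = 0 then 0 else (- 1) ^ (k - 1) * monom 1 k))"
    by (rule fps_ext) (simp add: distrib_left fps_of_nat[symmetric])
  then show "fps_X * fps_deriv ((elem_series * added_var_series) ^ N) =
      ?C * (elem_series * added_var_series) ^ N"
    using log_derivative_power[OF log_derivative_mult[OF log_derivative_elem_series
          log_derivative_added_var_series]] by simp
  have "partitions 0 = {{#}}"
    by (auto simp: partitions_def) (metis multiset_nonemptyE)
  then show "Abs_fps (\<lambda>n. elem_pleth n N) $ 0 = (elem_series * added_var_series) ^ N $ 0"
    by (simp add: elem_pleth_eq_cycle_index scalar.cycle_index_term_def zee_def elem_series_def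
        added_var_series_def elem_sf_0 fps_power_zeroth one_pCons flip: one_pCons)
qed simp

section \<open>Excursions and bridges\<close>

definition walk_value :: "('a \<Rightarrow> int) \<Rightarrow> 'a list \<Rightarrow> int" where
  "walk_value st xs = sum_list (map st xs)"

lemma walk_value_simps [simp]:
  "walk_value st [] = 0"
  "walk_value st (x # xs) = st x + walk_value st xs"
  "walk_value st (xs @ ys) = walk_value st xs + walk_value st ys"
  by (simp_all add: walk_value_def)

definition bridges :: "('a \<Rightarrow> int) \<Rightarrow> nat \<Rightarrow> 'a list set" where
  "bridges st n = {xs. length xs = n \<and> walk_value st xs = 0}"

text \<open>
  The quantifier may run over all \<open>k\<close>: beyond the length of the list, \<open>take k xs\<close> is \<open>xs\<close>.
\<close>

definition excursions :: "('a \<Rightarrow> int) \<Rightarrow> nat \<Rightarrow> 'a list set" where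
  "excursions st n = {xs \<in> bridges st n. \<forall>k. walk_value st (take k xs) \<ge> 0}"

definition positive_until :: "('a \<Rightarrow> int) \<Rightarrow> nat \<Rightarrow> 'a list \<Rightarrow> bool" where
  "positive_until st c xs \<longleftrightarrow> (\<forall>k\<in>{1..c}. walk_value st (take k xs) > 0)"

text \<open>
  A walk of length \<open>n\<close> has \<open>n + 1\<close> positions. For a bridge the positions \<open>0\<close> and \<open>n\<close> have the same
  value, so the last minimum is never at \<open>0\<close> unless the bridge is empty; it singles out one of the \<open>n\<close>
  rotations.
\<close>

definition last_minimum :: "('a \<Rightarrow> int) \<Rightarrow> 'a list \<Rightarrow> nat" where
  "last_minimum st xs = (GREATEST r. r \<le> length xs \<and>
     (\<forall>k. walk_value st (take r xs) \<le> walk_value st (take k xs)))"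

lemma last_minimum_unique:
  assumes "r \<le> length xs" "\<And>k. k \<le> r \<Longrightarrow> walk_value st (take r xs) \<le> walk_value st (take k xs)"
    "\<And>k. r < k \<Longrightarrow> k \<le> length xs \<Longrightarrow> walk_value st (take r xs) < walk_value st (take k xs)"
  shows "last_minimum st xs = r"
  unfolding last_minimum_def
proof (rule Greatest_equality)
  have "walk_value st (take r xs) \<le> walk_value st (take k xs)" for k
  proof (cases "k \<le> length xs")
    case False
    then have "take k xs = take (length xs) xs" by simp
    then show ?thesis using assms(1) assms(3)[of "length xs"] by (cases "r = length xs") auto
  qed (use assms(2)[of k] assms(3)[of k] in linarith)
  then show "r \<le> length xs \<and> (\<forall>k. walk_value st (take r xs) \<le> walk_value st (take k xs))"
    using assms(1) by blast
next
  fix q assume "q \<le> length xs \<and> (\<forall>k. walk_value st (take q xs) \<le> walk_value st (take k xs))"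
  then show "q \<le> r" using assms(3)[of q] by (metis linorder_not_less)
qed

lemma last_minimum:
  fixes st :: "'a \<Rightarrow> int" and xs :: "'a list"
  defines "r \<equiv> last_minimum st xs"
  shows "r \<le> length xs"
    and "walk_value st (take r xs) \<le> walk_value st (take k xs)"
    and "r < k \<Longrightarrow> k \<le> length xs \<Longrightarrow> walk_value st (take r xs) < walk_value st (take k xs)"
proof -
  let ?V = "\<lambda>k. walk_value st (take k xs)"
  let ?P = "\<lambda>r. r \<le> length xs \<and> (\<forall>k. ?V r \<le> ?V k)"
  obtain q where q: "q \<le> length xs" "\<And>k. k \<le> length xs \<Longrightarrow> ?V q \<le> ?V k"
    using ex_min_if_finite[of "?V ` {..length xs}"] by (auto simp: not_less)
  have "?V q \<le> ?V k" for k
    using q(2)[of "min k (length xs)"] by (cases "k \<le> length xs") (simp_all add: min_def)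
  then have "?P q" using q by blast
  then have P: "?P r" unfolding r_def last_minimum_def
    by (rule GreatestI_nat[where b = "length xs"]) blast
  then show "r \<le> length xs" "?V r \<le> ?V k" by blast+
  show "?V r < ?V k" if "r < k" "k \<le> length xs"
  proof (rule ccontr)
    assume "\<not> ?V r < ?V k"
    then have "?P k" using P that by (metis linorder_not_less order_trans)
    then have "k \<le> r" unfolding r_def last_minimum_def
      by (rule Greatest_le_nat[where b = "length xs"]) blast
    then show False using that by simp
  qed
qed

lemma excursion_append:
  assumes "t \<in> excursions st k" "u \<in> excursions st m"
  shows "t @ u \<in> excursions st (k + m)"
  using assms by (auto simp: excursions_def bridges_def)

lemma excursion_split:
  assumes "t @ u \<in> excursions st n" "walk_value st t = 0"
  shows "t \<in> excursions st (length t)" "u \<in> excursions st (n - length t)"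
proof -
  have pos: "walk_value st (take k (t @ u)) \<ge> 0" for k
    using assms by (auto simp: excursions_def simp del: take_append)
  have "walk_value st (take k t) \<ge> 0" for k
    using pos[of "min k (length t)"] by (simp add: min_def split: if_splits)
  then show "t \<in> excursions st (length t)" using assms(2) by (simp add: excursions_def bridges_def)
  have "walk_value st (take k u) \<ge> 0" for k
    using pos[of "length t + k"] assms(2) by simp
  then show "u \<in> excursions st (n - length t)"
    using assms by (auto simp: excursions_def bridges_def)
qed

text \<open>
  The old starting point of the excursion \<open>u\<close> becomes position \<open>n - c\<close> of the rotated walk, and it is
  a minimum there. The positions after it come from the first \<open>c\<close> steps of \<open>u\<close>, where \<open>u\<close> is
  positive, so none of them is a minimum.
\<close>

lemma rotate_positive_excursion:
  assumes u: "u \<in> excursions st n" and c: "c \<le> n" and pos: "positive_until st c u"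
  shows "drop c u @ take c u \<in> bridges st n" "last_minimum st (drop c u @ take c u) = n - c"
proof -
  let ?f = "drop c u @ take c u"
  have len: "length u = n" and zero: "walk_value st u = 0"
    and nonneg: "walk_value st (take k u) \<ge> 0" for k
    using u by (auto simp: excursions_def bridges_def)
  have total: "walk_value st (take c u) + walk_value st (drop c u) = 0"
    using zero by (metis append_take_drop_id walk_value_simps(3))
  then show "?f \<in> bridges st n" using len by (simp add: bridges_def)
  show "last_minimum st ?f = n - c"
  proof (rule last_minimum_unique)
    have f: "walk_value st (take (n - c) ?f) = - walk_value st (take c u)"
      using total len c by simp
    fix k
    show "walk_value st (take (n - c) ?f) \<le> walk_value st (take k ?f)" if k: "k \<le> n - c"
    proof -
      have "take (c + k) u = take c u @ take k (drop c u)" by (simp add: take_add)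
      then have "walk_value st (take (c + k) u) = walk_value st (take c u) + walk_value st (take k ?f)"
        using k len by simp
      then show ?thesis using nonneg[of "c + k"] f by simp
    qed
    show "walk_value st (take (n - c) ?f) < walk_value st (take k ?f)"
      if k: "n - c < k" "k \<le> length ?f"
    proof -
      define q where "q = k - (n - c)"
      have q: "q \<in> {1..c}" using k len c by (auto simp: q_def)
      have "walk_value st (take k ?f) = walk_value st (drop c u) + walk_value st (take q u)"
        using k len c q by (simp add: q_def[symmetric] min_def)
      moreover have "walk_value st (take q u) > 0" using pos q unfolding positive_until_def by blast
      ultimately show ?thesis using total f by linarith
    qed
  qed (use len in simp)
qed

text \<open>
  Started at a minimum, a bridge stays nonnegative. Its first \<open>n - r\<close> steps then lead through the
  positions after the last minimum, where the values are strictly larger.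
\<close>

lemma rotate_bridge_at_last_minimum:
  fixes st :: "'a \<Rightarrow> int" and f :: "'a list"
  assumes f: "f \<in> bridges st n" and n: "n > 0"
  defines "r \<equiv> last_minimum st f"
  shows "r \<in> {1..n}" "drop r f @ take r f \<in> excursions st n"
    "positive_until st (n - r) (drop r f @ take r f)"
proof -
  note r = last_minimum[of st f, folded r_def]
  have len: "length f = n" and zero: "walk_value st f = 0" using f by (auto simp: bridges_def)
  have "r \<noteq> 0" using r(3)[of n] len zero n by (intro notI) simp
  then show "r \<in> {1..n}" using r(1) len by simp
  let ?u = "drop r f @ take r f"
  have total: "walk_value st (take r f) + walk_value st (drop r f) = 0"
    using zero by (metis append_take_drop_id walk_value_simps(3))
  have before: "walk_value st (take k ?u) = walk_value st (take (r + k) f) - walk_value st (take r f)"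
    if "k \<le> n - r" for k
  proof -
    have "take (r + k) f = take r f @ take k (drop r f)" by (simp add: take_add)
    then show ?thesis using that len by simp
  qed
  have after: "walk_value st (take k ?u) = walk_value st (take (min (k - (n - r)) r) f) - walk_value st (take r f)"
    if "n - r < k" for k
    using that len total by (simp add: min.commute)
  have "walk_value st (take k ?u) \<ge> 0" for k
    using before[of k] after[of k] r(2) by (cases "k \<le> n - r") (simp_all add: not_le)
  then show "?u \<in> excursions st n"
    using len total by (simp add: excursions_def bridges_def)
  show "positive_until st (n - r) ?u"
    using before r(3) len r(1) by (auto simp: positive_until_def simp del: take_append)
qed

definition last_zero :: "('a \<Rightarrow> int) \<Rightarrow> 'a list \<Rightarrow> nat \<Rightarrow> nat" where
  "last_zero st xs i = (GREATEST k. k \<le> i \<and> walk_value st (take k xs) = 0)"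

lemma last_zero: "last_zero st xs i \<le> i" "walk_value st (take (last_zero st xs i) xs) = 0"
  "last_zero st xs i < k \<Longrightarrow> k \<le> i \<Longrightarrow> walk_value st (take k xs) \<noteq> 0"
proof -
  let ?P = "\<lambda>k. k \<le> i \<and> walk_value st (take k xs) = 0"
  have "?P (last_zero st xs i)" unfolding last_zero_def
    by (rule GreatestI_nat[where k = 0 and b = i]) auto
  then show "last_zero st xs i \<le> i" "walk_value st (take (last_zero st xs i) xs) = 0" by auto
  show "walk_value st (take k xs) \<noteq> 0" if "last_zero st xs i < k" "k \<le> i"
  proof
    assume "walk_value st (take k xs) = 0"
    then have "k \<le> last_zero st xs i" unfolding last_zero_def
      using that by (intro Greatest_le_nat[where b = i]) auto
    then show False using that by simp
  qed
qed

lemma last_zero_append: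
  assumes "walk_value st t = 0" "positive_until st c u"
  shows "last_zero st (t @ u) (length t + c) = length t"
  unfolding last_zero_def
proof (rule Greatest_equality)
  fix k assume k: "k \<le> length t + c \<and> walk_value st (take k (t @ u)) = 0"
  show "k \<le> length t"
  proof (rule ccontr)
    assume "\<not> k \<le> length t"
    then have "k - length t \<in> {1..c}" using k by auto
    then have "walk_value st (take (k - length t) u) > 0" using assms(2) unfolding positive_until_def by blast
    then show False using assms(1) k \<open>\<not> k \<le> length t\<close> by simp
  qed
qed (use assms in simp)

text \<open>
  The left side counts excursions \<open>s\<close> with a marked step \<open>i\<close>. Let \<open>k\<close> be the last zero up to \<open>i\<close>.
  Cutting \<open>s\<close> at \<open>k\<close> and rotating the second part to the mark gives an excursion \<open>t\<close> of length
  \<open>n - j\<close> and a bridge \<open>f\<close> of length \<open>j = n - k\<close>. Conversely, rotating \<open>f\<close> to its last minimum and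
  appending it to \<open>t\<close> restores \<open>s\<close>, and \<open>i\<close> is read off from the amount of rotation. The case \<open>j = 0\<close>
  does not occur, since \<open>k \<le> i < n\<close>.
\<close>

theorem excursions_bridges_recurrence:
  fixes wt :: "'a \<Rightarrow> 'r::comm_ring_1"
  assumes fin: "\<And>n. finite (bridges st n)"
  defines "w \<equiv> \<lambda>xs. prod_list (map wt xs)"
  shows "of_nat n * sum w (excursions st n) =
    (\<Sum>j=1..n. sum w (bridges st j) * sum w (excursions st (n - j)))"
proof -
  have fin_exc: "finite (excursions st k)" for k
    by (rule finite_subset[OF _ fin[of k]]) (auto simp: excursions_def)
  have w_append: "w (xs @ ys) = w xs * w ys" for xs ys by (simp add: w_def)
  define cut where "cut = (\<lambda>(s, i). let k = last_zero st s i in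
    (n - k, drop i s @ take (i - k) (drop k s), take k s))"
  define glue where "glue = (\<lambda>(j :: nat, f, t). let r = last_minimum st f in
    (t @ drop r f @ take r f, n - r))"
  have "of_nat n * sum w (excursions st n) = (\<Sum>(s, i) \<in> excursions st n \<times> {..<n}. w s)"
    by (simp add: sum.cartesian_product[symmetric] sum_distrib_left)
  also have "\<dots> = (\<Sum>(j, f, t) \<in> (SIGMA j:{1..n}. bridges st j \<times> excursions st (n - j)). w f * w t)"
  proof (rule sum.reindex_bij_witness[of _ glue cut])
    fix x assume "x \<in> excursions st n \<times> {..<n}"
    then obtain s i where x: "x = (s, i)" and s: "s \<in> excursions st n" and i: "i < n" by auto
    define k c t u where "k = last_zero st s i" and "c = i - k" and "t = take k s" and "u = drop k s"
    have len: "length s = n" using s by (simp add: excursions_def bridges_def)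
    have k: "k \<le> i" and zero: "walk_value st t = 0" using last_zero[of st s i] by (simp_all add: k_def t_def)
    have tl: "length t = k" using k i len by (simp add: t_def)
    have tu: "s = t @ u" by (simp add: t_def u_def)
    have exc: "t \<in> excursions st k" "u \<in> excursions st (n - k)"
      using excursion_split[of t u st n] s zero tu tl by auto
    have pos: "positive_until st c u"
      unfolding positive_until_def
    proof
      fix q assume q: "q \<in> {1..c}"
      then have "k < k + q" "k + q \<le> i" using k by (auto simp: c_def)
      then have "walk_value st (take (k + q) s) \<noteq> 0"
        unfolding k_def by (rule last_zero(3))
      moreover have "walk_value st (take (k + q) s) = walk_value st (take q u)"
        using zero tl by (simp add: tu)
      moreover have "walk_value st (take q u) \<ge> 0" using exc(2) by (simp add: excursions_def)
      ultimately show "walk_value st (take q u) > 0" by simp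
    qed
    have cut: "cut x = (n - k, drop c u @ take c u, t)"
      using k by (simp add: cut_def x k_def[symmetric] Let_def u_def c_def t_def)
    have c: "c \<le> n - k" using i by (simp add: c_def)
    note rot = rotate_positive_excursion[OF exc(2) c pos]
    have ul: "length u = n - k" using len by (simp add: u_def)
    show "glue (cut x) = x"
      unfolding cut using k i by (simp add: glue_def rot(2) Let_def x ul) (simp add: tu c_def)
    show "cut x \<in> (SIGMA j:{1..n}. bridges st j \<times> excursions st (n - j))"
      using rot(1) exc k i by (auto simp: cut)
    have "w u = w (take c u) * w (drop c u)" by (simp flip: w_append)
    then show "(case cut x of (j, f, t) \<Rightarrow> w f * w t) = (case x of (s, i) \<Rightarrow> w s)"
      unfolding cut by (simp add: x tu w_append mult_ac)
  next
    fix y assume "y \<in> (SIGMA j:{1..n}. bridges st j \<times> excursions st (n - j))"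
    then obtain j f t where y: "y = (j, f, t)" and j: "j > 0" "j \<le> n"
      and f: "f \<in> bridges st j" and t: "t \<in> excursions st (n - j)" by auto
    define r u where "r = last_minimum st f" and "u = drop r f @ take r f"
    note rot = rotate_bridge_at_last_minimum[OF f j(1), folded r_def, folded u_def]
    have glue: "glue y = (t @ u, n - r)" by (simp add: glue_def y r_def u_def Let_def)
    have tl: "length t = n - j" and zero: "walk_value st t = 0" and fl: "length f = j"
      using t f by (auto simp: excursions_def bridges_def)
    have i: "n - r = length t + (j - r)" using rot(1) j tl by auto
    show "glue y \<in> excursions st n \<times> {..<n}"
      using excursion_append[OF t rot(2)] j rot(1) by (auto simp: glue)
    have lz: "last_zero st (t @ u) (n - r) = n - j"
      unfolding i tl[symmetric] by (rule last_zero_append[OF zero rot(3)])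
    have "n - r - (n - j) = j - r" "n - j \<le> n - r" using rot(1) j by auto
    then show "cut (glue y) = y"
      unfolding glue cut_def using j tl by (simp add: Let_def lz y) (simp add: u_def fl)
  qed
  also have "\<dots> = (\<Sum>j=1..n. \<Sum>(f, t) \<in> bridges st j \<times> excursions st (n - j). w f * w t)"
    by (rule sum.Sigma[symmetric]) (simp_all add: fin fin_exc)
  also have "\<dots> = (\<Sum>j=1..n. sum w (bridges st j) * sum w (excursions st (n - j)))"
    by (simp add: sum_product sum.cartesian_product)
  finally show ?thesis .
qed

section \<open>Schroeder paths as sequences of steps\<close>

fun advance :: "nat \<times> nat \<Rightarrow> step \<Rightarrow> nat \<times> nat" where
  "advance (u, v) Up = (u, v + 1)"
| "advance (u, v) Diag = (u + 1, v + 1)"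
| "advance (u, v) Right = (u + 1, v)"

text \<open>
  The inverse of \<open>path_steps\<close> for a given starting point.
\<close>

fun points :: "nat \<times> nat \<Rightarrow> step list \<Rightarrow> (nat \<times> nat) list" where
  "points P [] = [P]"
| "points P (s # ss) = P # points (advance P s) ss"

lemma step_between_eq_Some: "step_between P Q = Some s \<longleftrightarrow> Q = advance P s"
  by (cases P; cases Q; cases s) auto

lemma points_ne_Nil [simp]: "points P ss \<noteq> []"
  by (cases ss) auto

lemma hd_points [simp]: "hd (points P ss) = P"
  by (cases ss) auto

lemma last_points: "last (points P ss) = foldl advance P ss"
  by (induction P ss rule: points.induct) auto

lemma points_append: "points P (ss @ [s]) = points P ss @ [foldl advance P (ss @ [s])]"
  by (induction P ss rule: points.induct) auto

lemma successively_points: "successively (\<lambda>P Q. step_between P Q \<noteq> None) (points P ss)"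
  by (induction P ss rule: points.induct)
    (auto simp: successively_Cons step_between_eq_Some simp del: step_between.simps)

lemma path_steps_simps [simp]:
  "path_steps [P] = []"
  "path_steps (P # Q # \<alpha>) = the (step_between P Q) # path_steps (Q # \<alpha>)"
  by (simp_all add: path_steps_def)

lemma path_steps_points [simp]: "path_steps (points P ss) = ss"
proof (induction P ss rule: points.induct)
  case (2 P s ss)
  obtain \<alpha> where \<alpha>: "points (advance P s) ss = advance P s # \<alpha>"
    by (metis hd_points points_ne_Nil list.exhaust_sel)
  have "step_between P (advance P s) = Some s" by (simp only: step_between_eq_Some)
  then show ?case using 2 by (simp add: \<alpha> del: step_between.simps)
qed simp

lemma points_path_steps:
  assumes "successively (\<lambda>P Q. step_between P Q \<noteq> None) \<alpha>" "\<alpha> \<noteq> []"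
  shows "points (hd \<alpha>) (path_steps \<alpha>) = \<alpha>"
  using assms
proof (induction \<alpha> rule: induct_list012)
  case (3 P Q \<alpha>)
  then have "step_between P Q \<noteq> None" "successively (\<lambda>P Q. step_between P Q \<noteq> None) (Q # \<alpha>)"
    by (simp_all only: successively.simps not_False_eq_True)
  moreover then obtain s where "step_between P Q = Some s" by blast
  moreover then have "Q = advance P s" by (simp only: step_between_eq_Some)
  ultimately show ?case using "3.IH"(2) by (simp del: step_between.simps)
qed auto

section \<open>Columns of a Schroeder path\<close>

text \<open>
  A pair \<open>(k, d)\<close> stands for \<open>k\<close> up steps followed by a diagonal step if \<open>d\<close> holds, and by a right
  step otherwise.
\<close>

type_synonym column = "nat \<times> bool"

fun height :: "column \<Rightarrow> nat" where
  "height (k, d) = k + of_bool d"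

fun column_weight :: "column \<Rightarrow> symfun poly" where
  "column_weight (k, d) = monom (elem_sf k) (of_bool d)"

fun column_steps :: "column \<Rightarrow> step list" where
  "column_steps (k, d) = replicate k Up @ [if d then Diag else Right]"

definition steps_of :: "column list \<Rightarrow> step list" where
  "steps_of cs = concat (map column_steps cs)"

lemma steps_of_simps [simp]: "steps_of [] = []" "steps_of (c # cs) = column_steps c @ steps_of cs"
  by (simp_all add: steps_of_def)

text \<open>
  Up steps at the end of the path, which belong to no column, are dropped.
\<close>

fun columns :: "step list \<Rightarrow> column list" where
  "columns [] = []"
| "columns (Diag # ss) = (0, True) # columns ss"
| "columns (Right # ss) = (0, False) # columns ss"
| "columns (Up # ss) = (case columns ss of [] \<Rightarrow> [] | (k, d) # cs \<Rightarrow> (Suc k, d) # cs)"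

lemma columns_steps_of [simp]: "columns (steps_of cs) = cs"
proof (induction cs)
  case (Cons c cs)
  have "columns (replicate k Up @ [if d then Diag else Right] @ steps_of cs) = (k, d) # cs" for k d
    by (induction k) (use Cons in auto)
  then show ?case by (cases c) simp
qed simp

lemma steps_of_columns:
  assumes "ss = [] \<or> last ss \<noteq> Up"
  shows "steps_of (columns ss) = ss"
  using assms
proof (induction ss rule: columns.induct)
  case (4 ss)
  then have "ss \<noteq> []" "steps_of (columns ss) = ss" by (auto split: if_splits)
  moreover then obtain c cs where "columns ss = c # cs" by (metis steps_of_simps(1) list.exhaust)
  ultimately show ?case by (cases c) auto
qed (auto split: if_splits)

lemma foldl_advance_steps_of:
  "foldl advance (u, v) (steps_of cs) = (u + length cs, v + sum_list (map height cs))"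
proof (induction cs arbitrary: u v)
  case (Cons c cs)
  have up: "foldl advance (u, v) (replicate k Up) = (u, v + k)" for k v
    by (induction k arbitrary: v) auto
  show ?case by (cases c) (simp add: up Cons)
qed simp

text \<open>
  Each column ends with a step that is not an up step, so no riser extends over two columns; but a
  column without up steps has no riser.
\<close>

lemma riser_lengths_steps_of:
  "riser_lengths (steps_of cs) = filter (\<lambda>k. k > 0) (map fst cs)"
proof (induction cs)
  case (Cons c cs)
  have tw: "takeWhile (\<lambda>t. t = Up) (replicate k Up @ (if d then Diag else Right) # ss) = replicate k Up"
    "dropWhile (\<lambda>t. t = Up) (replicate k Up @ (if d then Diag else Right) # ss) =
      (if d then Diag else Right) # ss" for k d ss
    by (induction k) auto
  obtain k d where c: "c = (k, d)" by (cases c)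
  show ?case using Cons by (cases k) (simp_all add: c tw)
qed simp

text \<open>
  The columns without riser contribute the factor \<open>e\<^sub>0 = 1\<close>.
\<close>

lemma prod_column_weight:
  "prod_list (map column_weight cs) =
    monom (prod_list (map elem_sf (riser_lengths (steps_of cs)))) (count_list (steps_of cs) Diag)"
proof (induction cs)
  case (Cons c cs)
  have "count_list (replicate k Up) Diag = 0" for k by (induction k) auto
  then show ?case using Cons unfolding riser_lengths_steps_of
    by (cases c) (auto simp: mult_monom elem_sf_0)
qed simp

text \<open>
  The gain in \<open>a y - b x\<close> along a column, where \<open>(x, y)\<close> is the current point: a column goes one unit to
  the right. A path lies weakly above the line of slope \<open>b / a\<close> if and only if \<open>a y - b x\<close> is
  nonnegative at all its points.
\<close>

definition column_rise :: "nat \<Rightarrow> nat \<Rightarrow> column \<Rightarrow> int" where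
  "column_rise a b c = int a * int (height c) - int b"

lemma walk_value_column_rise:
  "walk_value (column_rise a b) cs = int a * int (sum_list (map height cs)) - int b * int (length cs)"
  by (induction cs) (simp_all add: column_rise_def algebra_simps)

text \<open>
  Within a column \<open>a y - b x\<close> does not decrease, so only the point where the path enters a column
  matters.
\<close>

lemma points_above_iff:
  "(\<forall>(x, y) \<in> set (points (u, v) (steps_of cs)). int a * int y - int b * int x \<ge> 0) \<longleftrightarrow>
   (\<forall>k. int a * int v - int b * int u + walk_value (column_rise a b) (take k cs) \<ge> 0)"
proof (induction cs arbitrary: u v)
  case (Cons c cs)
  have all_nat: "(\<forall>j. P j) \<longleftrightarrow> P 0 \<and> (\<forall>j. P (Suc j))" for P
    by (metis not0_implies_Suc)
  obtain k d where c: "c = (k, d)" by (cases c)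
  let ?above = "\<lambda>P. case P of (x, y) \<Rightarrow> int a * int y - int b * int x \<ge> 0"
  have up: "(\<forall>P \<in> set (points (u, v) (replicate k Up @ ss)). ?above P) \<longleftrightarrow>
      ?above (u, v) \<and> (\<forall>P \<in> set (points (u, v + k) ss). ?above P)" for k v ss
  proof (induction k arbitrary: v)
    case 0
    then show ?case by (cases ss) auto
  next
    case (Suc k)
    have "?above (u, v) \<Longrightarrow> ?above (u, Suc v)" by (simp add: algebra_simps)
    then show ?case using Suc[of "Suc v"] by auto
  qed
  have "?above (u, v) \<Longrightarrow> ?above (u, v + k)" by (simp add: algebra_simps add_increasing)
  then have "(\<forall>P \<in> set (points (u, v) (steps_of (c # cs))). ?above P) \<longleftrightarrow>
      ?above (u, v) \<and> (\<forall>P \<in> set (points (u + 1, v + height c) (steps_of cs)). ?above P)"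
    using up[of v k "(if d then Diag else Right) # steps_of cs"] by (cases d) (auto simp: c)
  also have "\<dots> \<longleftrightarrow> ?above (u, v) \<and> (\<forall>j. int a * int v - int b * int u +
      walk_value (column_rise a b) (take (Suc j) (c # cs)) \<ge> 0)"
    unfolding Cons by (simp add: column_rise_def algebra_simps)
  also have "\<dots> \<longleftrightarrow> (\<forall>j. int a * int v - int b * int u + walk_value (column_rise a b) (take j (c # cs)) \<ge> 0)"
    using all_nat[of "\<lambda>j. int a * int v - int b * int u + walk_value (column_rise a b) (take j (c # cs)) \<ge> 0"]
    by simp
  finally show ?case .
qed simp

text \<open>
  The point directly below the end point \<open>(ad, bd)\<close> is below the diagonal.
\<close>

lemma path_ends_with_right_or_diagonal:
  assumes "a > 0" and \<alpha>: "points (0, 0) ss \<in> schroeder_paths (a * d) (b * d)" and "d > 0"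
  shows "ss = [] \<or> last ss \<noteq> Up"
proof (rule ccontr)
  assume "\<not> ?thesis"
  then obtain ss' where ss: "ss = ss' @ [Up]" by (metis append_butlast_last_id)
  obtain u v where uv: "foldl advance (0, 0) ss' = (u, v)" by (cases "foldl advance (0, 0) ss'")
  have "last (points (0, 0) ss) = (a * d, b * d)" using \<alpha> by (simp add: schroeder_paths_def)
  then have final: "u = a * d" "Suc v = b * d" using uv by (simp_all add: ss points_append)
  have "last (points (0, 0) ss') \<in> set (points (0, 0) ss)"
    by (simp add: ss points_append)
  then have "(u, v) \<in> set (points (0, 0) ss)" by (simp add: last_points uv)
  then have "int (b * d) * int u \<le> int (a * d) * int v"
    using \<alpha> by (auto simp: schroeder_paths_def)
  then have "b * d * (a * d) \<le> a * d * v" unfolding final by (simp flip: of_nat_mult)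
  then have "b * d \<le> v" using assms(1,3) by (simp add: mult.commute[of "a * d"])
  then show False using final(2) by simp
qed

lemma schroeder_enum_eq_excursions:
  assumes "a > 0"
  shows "schroeder_enum (a * d) (b * d) =
    (\<Sum>cs \<in> excursions (column_rise a b) (a * d). prod_list (map column_weight cs))"
proof (cases "d = 0")
  case True
  have "excursions (column_rise a b) 0 = {[]}" by (auto simp: excursions_def bridges_def)
  then show ?thesis using True by (simp add: schroeder_enum_0_0)
next
  case False
  then have d: "d > 0" by simp
  have above: "int (a * d) * int y - int (b * d) * int x \<ge> 0 \<longleftrightarrow> int a * int y - int b * int x \<ge> 0" for x y
  proof -
    have "int (a * d) * int y - int (b * d) * int x = int d * (int a * int y - int b * int x)"
      by (simp add: algebra_simps)
    then show ?thesis using d by (simp add: zero_le_mult_iff)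
  qed
  have mem: "points (0, 0) (steps_of cs) \<in> schroeder_paths (a * d) (b * d) \<longleftrightarrow>
      cs \<in> excursions (column_rise a b) (a * d)" for cs
  proof -
    have "points (0, 0) (steps_of cs) \<in> schroeder_paths (a * d) (b * d) \<longleftrightarrow>
        (\<forall>k. walk_value (column_rise a b) (take k cs) \<ge> 0) \<and>
        length cs = a * d \<and> sum_list (map height cs) = b * d"
      using points_above_iff[of 0 0 cs a b]
      by (simp only: schroeder_paths_def mem_Collect_eq above points_ne_Nil hd_points last_points
          foldl_advance_steps_of successively_points) auto
    moreover have "length cs = a * d \<Longrightarrow> sum_list (map height cs) = b * d \<longleftrightarrow>
        walk_value (column_rise a b) cs = 0"
      using assms by (auto simp: walk_value_column_rise mult_ac simp flip: of_nat_mult)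
    ultimately show ?thesis by (auto simp: excursions_def bridges_def)
  qed
  have inverse: "points (0, 0) (path_steps \<alpha>) = \<alpha> \<and> steps_of (columns (path_steps \<alpha>)) = path_steps \<alpha>"
    if "\<alpha> \<in> schroeder_paths (a * d) (b * d)" for \<alpha>
  proof -
    have "points (0, 0) (path_steps \<alpha>) = \<alpha>"
      using points_path_steps[of \<alpha>] that by (auto simp: schroeder_paths_def)
    then show ?thesis
      using path_ends_with_right_or_diagonal[OF assms _ d] that steps_of_columns by metis
  qed
  have mem_inverse: "columns (path_steps \<alpha>) \<in> excursions (column_rise a b) (a * d)"
    if "\<alpha> \<in> schroeder_paths (a * d) (b * d)" for \<alpha>
    using inverse[OF that] mem[of "columns (path_steps \<alpha>)"] that by simp
  show ?thesis
    unfolding schroeder_enum_def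
    by (rule sum.reindex_bij_witness[of _ "\<lambda>cs. points (0, 0) (steps_of cs)" "\<lambda>\<alpha>. columns (path_steps \<alpha>)"])
      (use inverse mem mem_inverse in \<open>auto simp: path_weight_def path_risers_def path_diag_def prod_column_weight\<close>)
qed

section \<open>Enumeration of Schroeder paths\<close>

lemma finite_lists_of_height:
  assumes "\<And>h. finite {x. ht x = (h::nat)}"
  shows "finite {xs. length xs = N \<and> sum_list (map ht xs) = h}"
proof (rule finite_subset)
  have "finite (\<Union>k\<le>h. {x. ht x = k})" using assms by blast
  then show "finite {xs. set xs \<subseteq> (\<Union>k\<le>h. {x. ht x = k}) \<and> length xs = N}"
    by (rule finite_lists_length_eq)
  show "{xs. length xs = N \<and> sum_list (map ht xs) = h} \<subseteq>
      {xs. set xs \<subseteq> (\<Union>k\<le>h. {x. ht x = k}) \<and> length xs = N}"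
    by (auto intro!: member_le_sum_list)
qed

lemma power_nth_lists_of_height:
  fixes wt :: "'a \<Rightarrow> 'r::comm_ring_1"
  assumes fin: "\<And>h. finite {x. ht x = (h::nat)}"
  shows "fps_nth (Abs_fps (\<lambda>h. sum wt {x. ht x = h}) ^ N) h =
    (\<Sum>xs | length xs = N \<and> sum_list (map ht xs) = h. prod_list (map wt xs))"
proof (induction N arbitrary: h)
  case 0
  have "{xs. length xs = 0 \<and> sum_list (map ht xs) = h} = (if h = 0 then {[]} else {})" by auto
  then show ?case by simp
next
  case (Suc N)
  let ?L = "\<lambda>N h. {xs. length xs = N \<and> sum_list (map ht xs) = h}"
  let ?w = "\<lambda>xs. prod_list (map wt xs)"
  have "fps_nth (Abs_fps (\<lambda>h. sum wt {x. ht x = h}) ^ Suc N) h =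
      (\<Sum>k=0..h. sum wt {x. ht x = k} * sum ?w (?L N (h - k)))"
    by (simp add: fps_mult_nth Suc)
  also have "\<dots> = (\<Sum>k=0..h. \<Sum>(x, xs) \<in> {x. ht x = k} \<times> ?L N (h - k). wt x * ?w xs)"
    by (simp add: sum_product sum.cartesian_product)
  also have "\<dots> = (\<Sum>(k, x, xs) \<in> (SIGMA k:{0..h}. {x. ht x = k} \<times> ?L N (h - k)). wt x * ?w xs)"
    by (rule sum.Sigma) (simp_all add: fin finite_lists_of_height[OF fin])
  also have "\<dots> = sum ?w (?L (Suc N) h)"
    by (rule sum.reindex_bij_witness[of _ "\<lambda>xs. (ht (hd xs), hd xs, tl xs)" "\<lambda>(k, x, xs). x # xs"])
      (auto simp: length_Suc_conv)
  finally show ?case .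
qed

lemma column_generating_function:
  "Abs_fps (\<lambda>h. \<Sum>c | height c = h. column_weight c) = elem_series * added_var_series"
proof (rule fps_ext)
  fix h
  have "{c. height c = h} = (if h = 0 then {(0, False)} else {(h, False), (h - 1, True)})"
    by (auto split: if_splits)
  then show "Abs_fps (\<lambda>h. \<Sum>c | height c = h. column_weight c) $ h = (elem_series * added_var_series) $ h"
    by (cases h) (simp_all add: elem_series_def added_var_series_def distrib_left
        mult.assoc[symmetric] monom_0 mult_monom smult_monom)
qed

lemma finite_height: "finite {c. height c = h}"
  by (rule finite_subset[of _ "{..h} \<times> UNIV"]) auto

lemma bridges_eq_height:
  assumes "a > 0"
  shows "bridges (column_rise a b) (a * j) = {cs. length cs = j * a \<and> sum_list (map height cs) = j * b}"
  using assms by (auto simp: bridges_def walk_value_column_rise mult_ac simp flip: of_nat_mult)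

lemma elem_pleth_eq_bridges:
  assumes "a > 0"
  shows "elem_pleth (j * b) (j * a) =
    (\<Sum>cs \<in> bridges (column_rise a b) (a * j). prod_list (map column_weight cs))"
proof -
  have "elem_pleth (j * b) (j * a) = Abs_fps (\<lambda>n. elem_pleth n (j * a)) $ (j * b)" by simp
  then show ?thesis
    unfolding elem_pleth_generating_function column_generating_function[symmetric]
      bridges_eq_height[OF assms]
    by (simp only: power_nth_lists_of_height[OF finite_height])
qed

lemma finite_column_bridges:
  assumes "a > 0"
  shows "finite (bridges (column_rise a b) n)"
proof (rule finite_subset)
  show "finite (\<Union>h\<le>b * n. {cs. length cs = n \<and> sum_list (map height cs) = h})"
    using finite_lists_of_height[OF finite_height] by blast
  show "bridges (column_rise a b) n \<subseteq> (\<Union>h\<le>b * n. {cs. length cs = n \<and> sum_list (map height cs) = h})"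
  proof
    fix cs assume cs: "cs \<in> bridges (column_rise a b) n"
    then have "a * sum_list (map height cs) = b * n"
      by (auto simp: bridges_def walk_value_column_rise simp flip: of_nat_mult)
    then have "sum_list (map height cs) \<le> b * n" using assms by (metis mult_le_mono1 nat_mult_1 Suc_leI One_nat_def)
    then show "cs \<in> (\<Union>h\<le>b * n. {cs. length cs = n \<and> sum_list (map height cs) = h})"
      using cs by (auto simp: bridges_def)
  qed
qed

lemma column_bridges_empty:
  assumes "coprime a b" "\<not> a dvd n"
  shows "bridges (column_rise a b) n = {}"
proof -
  have "a dvd n" if "cs \<in> bridges (column_rise a b) n" for cs
  proof -
    have "a * sum_list (map height cs) = b * n"
      using that by (auto simp: bridges_def walk_value_column_rise simp flip: of_nat_mult)
    then have "a dvd b * n" by (metis dvd_triv_left)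
    then show ?thesis using assms(1) by (simp add: coprime_dvd_mult_right_iff)
  qed
  then show ?thesis using assms(2) by blast
qed

text \<open>
  This is the recurrence between excursions and bridges at length \<open>ad\<close>, where only the bridges of
  length \<open>aj\<close> contribute.
\<close>

theorem schroeder_enum_recurrence:
  assumes a: "a > 0" and ab: "coprime a b"
  shows "of_nat (a * d) * schroeder_enum (a * d) (b * d) =
    (\<Sum>j=1..d. elem_pleth (j * b) (j * a) * schroeder_enum (a * (d - j)) (b * (d - j)))"
proof -
  let ?st = "column_rise a b" and ?w = "\<lambda>cs. prod_list (map column_weight cs)"
  have "of_nat (a * d) * schroeder_enum (a * d) (b * d) =
      (\<Sum>i=1..a * d. sum ?w (bridges ?st i) * sum ?w (excursions ?st (a * d - i)))"
    unfolding schroeder_enum_eq_excursions[OF a]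
    by (rule excursions_bridges_recurrence[OF finite_column_bridges[OF a]])
  also have "\<dots> = (\<Sum>i \<in> (\<lambda>j. a * j) ` {1..d}. sum ?w (bridges ?st i) * sum ?w (excursions ?st (a * d - i)))"
  proof (rule sum.mono_neutral_right)
    show "(\<lambda>j. a * j) ` {1..d} \<subseteq> {1..a * d}" using a by auto
    show "\<forall>i \<in> {1..a * d} - (\<lambda>j. a * j) ` {1..d}.
        sum ?w (bridges ?st i) * sum ?w (excursions ?st (a * d - i)) = 0"
    proof
      fix i assume i: "i \<in> {1..a * d} - (\<lambda>j. a * j) ` {1..d}"
      have "\<not> a dvd i"
      proof
        assume "a dvd i"
        then obtain j where "i = a * j" by blast
        then show False using i a by (auto simp: image_iff Suc_le_eq)
      qed
      then show "sum ?w (bridges ?st i) * sum ?w (excursions ?st (a * d - i)) = 0"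
        by (simp add: column_bridges_empty[OF ab])
    qed
  qed simp
  also have "\<dots> = (\<Sum>j=1..d. sum ?w (bridges ?st (a * j)) * sum ?w (excursions ?st (a * d - a * j)))"
    by (subst sum.reindex) (use a in \<open>auto simp: inj_on_def\<close>)
  also have "\<dots> = (\<Sum>j=1..d. elem_pleth (j * b) (j * a) * schroeder_enum (a * (d - j)) (b * (d - j)))"
    by (simp only: schroeder_enum_eq_excursions[OF a] elem_pleth_eq_bridges[OF a] diff_mult_distrib2[symmetric])
  finally show ?thesis .
qed

text \<open>
  With \<open>L\<close> for the exponent, \<open>T\<^sub>j = e\<^sub>j\<^sub>b[ja(x + y)]\<close> is \<open>a j\<close> times the coefficient of \<open>z\<^sup>j\<close> in \<open>L\<close>.
  Hence the recurrence says that \<open>z L'(z)\<close> is the logarithmic derivative of the generating function of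
  the Schroeder paths.
\<close>

theorem proposition1:
  fixes a b :: nat
  assumes "a > 0" and "b > 0" and "coprime a b"
  shows "Abs_fps (\<lambda>d. schroeder_enum (a * d) (b * d)) =
    symfun_fps_exp (Abs_fps (\<lambda>j. if j = 0 then 0
      else smult (sf_const (1 / of_nat (a * j))) (elem_pleth (j * b) (j * a))))"
proof (rule scalar.log_derivative_unique)
  let ?S = "\<lambda>d. schroeder_enum (a * d) (b * d)"
  let ?T = "\<lambda>j. elem_pleth (j * b) (j * a)"
  let ?L = "Abs_fps (\<lambda>j. if j = 0 then 0 else smult (sf_const (1 / of_nat (a * j))) (?T j))"
  show "fps_X * fps_deriv (symfun_fps_exp ?L) = (fps_X * fps_deriv ?L) * symfun_fps_exp ?L"
    unfolding symfun_fps_exp_def by (rule scalar.log_derivative_exp) simp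
  have L: "of_nat a * (fps_X * fps_deriv ?L) $ j = ?T j" if "j > 0" for j
  proof -
    have "of_nat (a * j) * scalar (1 / of_nat (a * j)) = 1"
      unfolding scalar.scalar_of_nat[symmetric] scalar.scalar_mult[symmetric]
      using that assms(1) by simp
    then have "of_nat a * (of_nat j * (scalar (1 / of_nat (a * j)) * ?T j)) = ?T j"
      by (simp only: of_nat_mult mult.assoc[symmetric] mult_1)
    then show ?thesis
      unfolding fps_X_mult_deriv_nth using that by (simp only: fps_nth_Abs_fps smult_sf_const) simp
  qed
  show "fps_X * fps_deriv (Abs_fps ?S) = (fps_X * fps_deriv ?L) * Abs_fps ?S"
  proof (rule fps_ext, rule scalar.of_nat_mult_cancel[OF _ assms(1)])
    fix d
    have "of_nat a * (fps_X * fps_deriv (Abs_fps ?S)) $ d = (\<Sum>j=1..d. ?T j * ?S (d - j))"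
      using schroeder_enum_recurrence[OF assms(1,3), of d]
      unfolding fps_X_mult_deriv_nth by (simp add: mult.assoc)
    also have "\<dots> = (\<Sum>j=0..d. of_nat a * ((fps_X * fps_deriv ?L) $ j * ?S (d - j)))"
    proof (rule sum.mono_neutral_cong_left)
      show "?T j * ?S (d - j) = of_nat a * ((fps_X * fps_deriv ?L) $ j * ?S (d - j))"
        if "j \<in> {1..d}" for j
        unfolding mult.assoc[symmetric] using L[of j] that by simp
    qed auto
    also have "\<dots> = of_nat a * ((fps_X * fps_deriv ?L) * Abs_fps ?S) $ d"
      by (simp only: fps_mult_nth[of "fps_X * fps_deriv ?L"] sum_distrib_left fps_nth_Abs_fps)
    finally show "of_nat a * (fps_X * fps_deriv (Abs_fps ?S)) $ d =
        of_nat a * ((fps_X * fps_deriv ?L) * Abs_fps ?S) $ d" .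
  qed
  show "Abs_fps ?S $ 0 = symfun_fps_exp ?L $ 0"
    by (simp add: schroeder_enum_0_0 symfun_fps_exp_def)
qed simp

end
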